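(* Let $F\in L^1(\mathbb{C})\cap L^\infty(\mathbb{C})$ be a real-valued symbol, not almost everywhere zero, which is radial with respect to a point $a\in\mathbb{C}$. Then the localization operator $H_F:L^2(\mathbb{R})\to L^2(\mathbb{R})$ satisfies $$\|H_F\|\leq\|F\|_\infty\left(1-\exp\left(-\frac{\|F\|_1}{\|F\|_\infty}\right)\right).$$
   Context: $dA$ denotes Lebesgue measure on $\mathbb{C}\cong\mathbb{R}^2$. For $z=x+i\omega\in\mathbb{C}$ the time-frequency shift $\pi(z)$ is $(\pi(z)f)(t)=e^{2\pi i\omega t}f(t-x)$ for $f\in L^2(\mathbb{R})$, and $h_0(t)=2^{1/4}e^{-\pi t^2}$ is the Gaussian. For $F\in L^1(\mathbb{C})$ the localization operator $H_F:L^2(\mathbb{R})\to L^2(\mathbb{R})$ is $$H_Ff=\int_{\mathbb{C}}F(z)\,\langle f,\pi(z)h_0\rangle\,\pi(z)h_0\,dA(z),$$ with $\langle\cdot,\cdot\rangle$ the $L^2(\mathbb{R})$ inner product. $\|H_F\|$ is the operator norm; $\|F\|_1$ and $\|F\|_\infty$ are the norms in $L^1(\mathbb{C},dA)$ and $L^\infty(\mathbb{C},dA)$. The symbol $F$ is radial with respect to $a\in\mathbb{C}$ if $F(z)=g(|z-a|)$ for some bounded measurable function $g$ on $[0,+\infty)$. *)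

theory Defs
  imports "HOL-Analysis.Analysis" "HOL-Probability.Essential_Supremum"
begin

text \<open>Elements of Lebesgue spaces are represented by functions rather than by classes modulo
  null sets; all notions below are unaffected by changes on null sets, except that operators on
  \<open>L\<^sup>2\<close> return one specific representative.\<close>

definition L1 :: "'a measure \<Rightarrow> ('a \<Rightarrow> 'b::{banach, second_countable_topology}) set"
  where "L1 M = {f. integrable M f}"

definition L1_norm :: "'a measure \<Rightarrow> ('a \<Rightarrow> 'b::{banach, second_countable_topology}) \<Rightarrow> real"
  where "L1_norm M f = (LINT x|M. norm (f x))"

definition Linf :: "'a measure \<Rightarrow> ('a \<Rightarrow> 'b::{banach, second_countable_topology}) set"
  where "Linf M = {f \<in> borel_measurable M. esssup M (\<lambda>x. ereal (norm (f x))) < \<infinity>}"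

definition Linf_norm :: "'a measure \<Rightarrow> ('a \<Rightarrow> 'b::{banach, second_countable_topology}) \<Rightarrow> real"
  where "Linf_norm M f = real_of_ereal (esssup M (\<lambda>x. ereal (norm (f x))))"

definition L2_real :: "(real \<Rightarrow> complex) set"
  where "L2_real = {f \<in> borel_measurable lebesgue. integrable lebesgue (\<lambda>t. (cmod (f t))\<^sup>2)}"

definition L2_norm :: "(real \<Rightarrow> complex) \<Rightarrow> real"
  where "L2_norm f = sqrt (LINT t|lebesgue. (cmod (f t))\<^sup>2)"

definition L2_inner :: "(real \<Rightarrow> complex) \<Rightarrow> (real \<Rightarrow> complex) \<Rightarrow> complex"
  where "L2_inner f g = (LINT t|lebesgue. f t * cnj (g t))"

text \<open>The supremum is taken in the extended reals, so that the norm of an unbounded operator is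
  \<open>\<infinity>\<close>. It is meaningful for operators that map \<open>L\<^sup>2\<close> into itself.\<close>

definition L2_op_norm :: "((real \<Rightarrow> complex) \<Rightarrow> (real \<Rightarrow> complex)) \<Rightarrow> ereal"
  where "L2_op_norm T = (SUP f\<in>{f \<in> L2_real. L2_norm f \<le> 1}. ereal (L2_norm (T f)))"

definition tf_shift :: "complex \<Rightarrow> (real \<Rightarrow> complex) \<Rightarrow> real \<Rightarrow> complex"
  where "tf_shift z f t =
    exp (2 * of_real pi * \<i> * of_real (Im z) * of_real t) * f (t - Re z)"

definition gauss_window :: "real \<Rightarrow> complex"
  where "gauss_window t = of_real (2 powr (1/4) * exp (- pi * t\<^sup>2))"

text \<open>The \<open>L\<^sup>2\<close>-valued integral is evaluated pointwise. For \<open>F\<close> in \<open>L\<^sup>1\<close> and \<open>f\<close> in \<open>L\<^sup>2\<close> the scalar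
  integral converges absolutely for every \<open>t\<close>, because \<open>\<bar>\<langle>f, \<pi>(z) h\<^sub>0\<rangle>\<bar>\<close> is at most the
  \<open>L\<^sup>2\<close> norm of \<open>f\<close> and \<open>h\<^sub>0\<close> is bounded; by Fubini it represents the vector-valued integral.\<close>

definition localization_op :: "(complex \<Rightarrow> complex) \<Rightarrow> (real \<Rightarrow> complex) \<Rightarrow> real \<Rightarrow> complex"
  where "localization_op F f t =
    (LINT z|lebesgue. F z * L2_inner f (tf_shift z gauss_window) * tf_shift z gauss_window t)"

definition radial_wrt :: "complex \<Rightarrow> (complex \<Rightarrow> real) \<Rightarrow> bool"
  where "radial_wrt a F \<longleftrightarrow>
    (\<exists>g :: real \<Rightarrow> real. g \<in> borel_measurable (lebesgue_on {0..}) \<and> bounded (g ` {0..}) \<and>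
       (AE z in lebesgue. F z = g (cmod (z - a))))"

end

(* By duality it suffices to bound the sesquilinear form
   (f, g) |-> int F(z) Vf(z) conj(Vg(z)) dA(z), where Vf(z) = <f, pi(z) h_0>. Translating the centre
   to 0 multiplies Vf and Vg by the same phase. For the centre 0, Vf(z) is, up to a phase,
   exp(-pi |z|^2 / 2) times a power series in conj(z) whose coefficients are the Hermite coefficients
   of f; for a radial symbol different powers are orthogonal, so the form is diagonal. Its eigenvalues
   are integrals of F against Gamma densities in pi |z|^2. The eigenvalue of index 0 is bounded by the
   bathtub principle, and a Gamma density is a convolution with the exponential density, so the others
   are averages of quantities obeying the same bound. Bessel's inequality for the Hermite functions
   and Cauchy-Schwarz conclude. *)
theory Submission
  imports Defs "HOL-Probability.Distributions" "HOL-Complex_Analysis.Cauchy_Integral_Formula"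
begin

section \<open>Gamma moments of bounded densities on the plane\<close>

text \<open>The variable q = pi |z|^2 carries planar Lebesgue measure to Lebesgue measure on the
  half line, so the area of an annulus is the difference of its two q-values. In this variable the
  constant explains itself: among densities bounded by M with mass L, the pairing with exp(-q) is
  largest for M times the indicator of the disc of area L/M, and its value is M (1 - exp(-L/M)). For
  the Gamma density of index k > 0 a direct bathtub argument would meet superlevel intervals around
  the peak q = k, with endpoints given only implicitly. Averaging replaces them by translates of
  exp(-q), and every translate obeys the same bound because its optimal region is again an annulus
  of area L/M. The moments are estimated for |F|, which covers symbols that change sign.
  Orthogonality of distinct powers comes from a single well-chosen rotation rather than from polar
  coordinates. Termwise integration of the power series is done for symbols supported in a disc,
  where both series converge uniformly; truncation then recovers integrable symbols.\<close>

lemma emeasure_annulus: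
  assumes "0 \<le> y" "y \<le> s"
  shows "emeasure lborel {z::complex. y \<le> pi * (cmod z)\<^sup>2 \<and> pi * (cmod z)\<^sup>2 \<le> s} = ennreal (s - y)"
proof -
  have cb: "(pi * (cmod z)\<^sup>2 \<le> s) = (z \<in> cball 0 (sqrt (s/pi)))" for z
    using real_sqrt_le_iff[of "(cmod z)\<^sup>2" "s/pi"] by (simp add: field_simps)
  have ba: "(y \<le> pi * (cmod z)\<^sup>2) = (z \<notin> ball 0 (sqrt (y/pi)))" for z
    using real_sqrt_le_iff[of "y/pi" "(cmod z)\<^sup>2"] assms by (simp add: not_less field_simps)
  have "{z::complex. y \<le> pi * (cmod z)\<^sup>2 \<and> pi * (cmod z)\<^sup>2 \<le> s}
      = cball 0 (sqrt (s/pi)) - ball 0 (sqrt (y/pi))"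
    unfolding cb ba by auto
  also have "emeasure lborel \<dots> = emeasure lborel (cball (0::complex) (sqrt (s/pi)))
      - emeasure lborel (ball (0::complex) (sqrt (y/pi)))"
  proof (intro emeasure_Diff)
    have "sqrt (y/pi) \<le> sqrt (s/pi)"
      using assms by (simp add: divide_right_mono)
    then show "ball (0::complex) (sqrt (y/pi)) \<subseteq> cball 0 (sqrt (s/pi))"
      by (meson ball_subset_cball order_trans subset_cball)
  qed (use assms in \<open>auto simp: emeasure_ball\<close>)
  also have "\<dots> = ennreal (s - y)"
    using assms by (simp add: emeasure_ball emeasure_cball unit_ball_vol_2 ennreal_minus)
  finally show ?thesis .
qed

lemma nn_integral_exp_Icc:
  fixes a b :: real
  assumes "a \<le> b"
  shows "(\<integral>\<^sup>+u. ennreal (exp (- u)) * indicator {a..b} u \<partial>lborel) = ennreal (exp (- a) - exp (- b))"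
proof -
  have "(\<integral>\<^sup>+u. ennreal (exp (- u)) * indicator {a..b} u \<partial>lborel)
      = ennreal ((- exp (- b)) - (- exp (- a)))"
    by (rule nn_integral_FTC_Icc[where F = "\<lambda>u. - exp (- u)"])
       (use assms in \<open>auto intro!: derivative_eq_intros\<close>)
  then show ?thesis by simp
qed

lemma nn_integral_power_Icc:
  assumes "0 \<le> (b::real)"
  shows "(\<integral>\<^sup>+u. ennreal (u ^ k / fact k) * indicator {0..b} u \<partial>lborel) = ennreal (b ^ Suc k / fact (Suc k))"
proof -
  have *: "DERIV (\<lambda>u. u ^ Suc k / fact (Suc k)) x :> x ^ k / fact k" for x :: real
  proof -
    have "real (Suc k) * x ^ k / fact (Suc k) = x ^ k / fact k"
      by (simp add: divide_simps del: of_nat_Suc)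
    then show ?thesis
      using DERIV_cdivide[OF DERIV_pow[of "Suc k" x UNIV], of "fact (Suc k)"] by (simp del: fact_Suc power_Suc of_nat_Suc)
  qed
  have "(\<integral>\<^sup>+u. ennreal (u ^ k / fact k) * indicator {0..b} u \<partial>lborel)
      = ennreal (b ^ Suc k / fact (Suc k) - 0 ^ Suc k / fact (Suc k))"
    by (rule nn_integral_FTC_Icc[where F = "\<lambda>u. u ^ Suc k / fact (Suc k)"])
       (use assms * in auto)
  then show ?thesis by simp
qed

text \<open>Layer cake: exp(-q) - exp(-S) is the integral of exp(-u) over [q, S]. After exchanging
  the integrals, each u contributes an annulus of area u whatever \<open>y\<close> is, so the
  integral of u exp(-u) over [0, S] remains.\<close>

lemma nn_integral_truncated_exp_annulus:
  fixes S y :: real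
  assumes "0 \<le> S" "0 \<le> y"
  shows "(\<integral>\<^sup>+z. ennreal (exp (- (pi * (cmod z)\<^sup>2 - y)) - exp (- S))
           * indicator {z. y \<le> pi * (cmod z)\<^sup>2 \<and> pi * (cmod z)\<^sup>2 \<le> y + S} z \<partial>(lborel :: complex measure))
       = ennreal (1 - exp (- S) - S * exp (- S))"
proof -
  let ?g = "\<lambda>(z::complex) (u::real). ennreal (exp (- u)) * indicator {0..S} u
     * indicator {z. y \<le> pi * (cmod z)\<^sup>2 \<and> pi * (cmod z)\<^sup>2 \<le> y + u} z :: ennreal"
  have [measurable]: "(\<lambda>(z, u). ?g z u) \<in> borel_measurable (lborel \<Otimes>\<^sub>M lborel)"
    unfolding indicator_def by measurable
  have "(\<integral>\<^sup>+z. ennreal (exp (- (pi * (cmod z)\<^sup>2 - y)) - exp (- S))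
           * indicator {z. y \<le> pi * (cmod z)\<^sup>2 \<and> pi * (cmod z)\<^sup>2 \<le> y + S} z \<partial>(lborel :: complex measure))
      = (\<integral>\<^sup>+z. (\<integral>\<^sup>+u. ?g z u \<partial>lborel) \<partial>lborel)"
  proof (intro nn_integral_cong)
    fix z :: complex
    define q where "q = pi * (cmod z)\<^sup>2 - y"
    show "ennreal (exp (- (pi * (cmod z)\<^sup>2 - y)) - exp (- S))
           * indicator {z. y \<le> pi * (cmod z)\<^sup>2 \<and> pi * (cmod z)\<^sup>2 \<le> y + S} z = (\<integral>\<^sup>+u. ?g z u \<partial>lborel)"
    proof (cases "0 \<le> q \<and> q \<le> S")
      case True
      have "(\<integral>\<^sup>+u. ?g z u \<partial>lborel) = (\<integral>\<^sup>+u. ennreal (exp (- u)) * indicator {q..S} u \<partial>lborel)"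
        using True by (intro nn_integral_cong) (auto simp: indicator_def q_def)
      then show ?thesis
        using True nn_integral_exp_Icc[of q S] by (simp add: q_def)
    next
      case False
      then have "?g z u = 0" for u
        by (auto simp: q_def indicator_def)
      then have "(\<integral>\<^sup>+u. ?g z u \<partial>lborel) = 0"
        by (simp del: mult_eq_0_iff)
      then show ?thesis
        using False by (auto simp: q_def indicator_def)
    qed
  qed
  also have "\<dots> = (\<integral>\<^sup>+u. (\<integral>\<^sup>+z. ?g z u \<partial>lborel) \<partial>lborel)"
    by (rule lborel_pair.Fubini'[symmetric]) measurable
  also have "\<dots> = (\<integral>\<^sup>+u. ennreal (u ^ 1 * exp (- u)) * indicator {0..S} u \<partial>lborel)"
  proof (intro nn_integral_cong)
    fix u :: real
    show "(\<integral>\<^sup>+z. ?g z u \<partial>lborel) = ennreal (u ^ 1 * exp (- u)) * indicator {0..S} u"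
    proof (cases "u \<in> {0..S}")
      case True
      then show ?thesis
        using assms emeasure_annulus[of y "y + u"]
        by (simp add: nn_integral_cmult ennreal_mult' mult.commute del: Collect_conj_eq)
    qed simp
  qed
  also have "\<dots> = ennreal (1 - exp (- S) - S * exp (- S))"
    using nn_intergal_power_times_exp_Icc[OF assms(1), of 1] by (simp add: algebra_simps)
  finally show ?thesis .
qed

text \<open>The mass is bounded by \<open>L\<close> instead of fixed, and the height is bounded only
  almost everywhere. Truncations of a symbol therefore satisfy the locale with the same
  \<open>L\<close> and \<open>M\<close>, and essential bounds fit directly.\<close>

locale bounded_density =
  fixes \<rho> :: "complex \<Rightarrow> real" and L M :: real
  assumes meas [measurable]: "\<rho> \<in> borel_measurable borel"
    and nonneg: "\<And>z. 0 \<le> \<rho> z"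
    and AE_le: "AE z in lborel. \<rho> z \<le> M"
    and mass: "(\<integral>\<^sup>+z. ennreal (\<rho> z) \<partial>lborel) \<le> ennreal L"
    and L: "0 \<le> L" and M: "0 < M"
begin

text \<open>Bathtub principle in pointwise form: for a weight e and the level exp(-S), one has
  \<rho> e \<le> exp(-S) \<rho> + M max(0, e - exp(-S)). Integrating gives exp(-S) L + M (1 -
  exp(-S) - S exp(-S)), and L = M S makes this collapse to M (1 - exp(-S)).\<close>

lemma exp_moment_le:
  assumes y: "0 \<le> y"
  shows "(\<integral>\<^sup>+z. ennreal (\<rho> z) * (ennreal (exp (- (pi * (cmod z)\<^sup>2 - y)))
            * indicator {z. y \<le> pi * (cmod z)\<^sup>2} z) \<partial>lborel) \<le> ennreal (M * (1 - exp (- (L / M))))"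
proof -
  \<comment> \<open>\<open>S\<close> is the area on which the extremal density \<open>M\<close>
    would have mass \<open>L\<close>; exp(-S) is the value of the weight on the outer boundary of
    that annulus.\<close>
  define S where "S = L / M"
  have S: "0 \<le> S" using L M by (simp add: S_def)
  have MS: "M * S = L" using M by (simp add: S_def)
  let ?A = "{z. y \<le> pi * (cmod z)\<^sup>2 \<and> pi * (cmod z)\<^sup>2 \<le> y + S}"
  have "(\<integral>\<^sup>+z. ennreal (\<rho> z) * (ennreal (exp (- (pi * (cmod z)\<^sup>2 - y)))
            * indicator {z. y \<le> pi * (cmod z)\<^sup>2} z) \<partial>lborel)
      \<le> (\<integral>\<^sup>+z. ennreal (exp (- S)) * ennreal (\<rho> z) + ennreal M *
           (ennreal (exp (- (pi * (cmod z)\<^sup>2 - y)) - exp (- S)) * indicator ?A z) \<partial>lborel)"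
  proof (intro nn_integral_mono_AE, use AE_le in eventually_elim)
    fix z assume le: "\<rho> z \<le> M"
    define e where "e = exp (- (pi * (cmod z)\<^sup>2 - y))"
    \<comment> \<open>The weight vanishes inside, is at least the level exp(-S) on
      \<open>?A\<close>, and is below it outside. The bound by \<open>M\<close> is used only on
      \<open>?A\<close>.\<close>
    consider "pi * (cmod z)\<^sup>2 < y" | "z \<in> ?A" | "y + S < pi * (cmod z)\<^sup>2" by force
    then show "ennreal (\<rho> z) * (ennreal (exp (- (pi * (cmod z)\<^sup>2 - y)))
            * indicator {z. y \<le> pi * (cmod z)\<^sup>2} z) \<le> ennreal (exp (- S)) * ennreal (\<rho> z) + ennreal M *
           (ennreal (exp (- (pi * (cmod z)\<^sup>2 - y)) - exp (- S)) * indicator ?A z)"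
    proof cases
      case 2
      then have "exp (- S) \<le> e" by (simp add: e_def)
      then have "\<rho> z * e \<le> exp (- S) * \<rho> z + M * (e - exp (- S))"
        using mult_right_mono[OF le, of "e - exp (- S)"] by (simp add: algebra_simps)
      then show ?thesis
        using 2 \<open>exp (- S) \<le> e\<close> M nonneg[of z]
        by (simp add: e_def[symmetric] flip: ennreal_mult ennreal_plus)
           (simp add: e_def flip: ennreal_mult ennreal_plus)
    next
      case 3
      then have "e \<le> exp (- S)" by (simp add: e_def)
      then have "\<rho> z * e \<le> exp (- S) * \<rho> z"
        using mult_right_mono[of e "exp (- S)" "\<rho> z"] nonneg[of z] by (simp add: algebra_simps)
      then show ?thesis
        using 3 S nonneg[of z] by (simp add: e_def flip: ennreal_mult)
    qed simp
  qed
  also have "\<dots> = ennreal (exp (- S)) * (\<integral>\<^sup>+z. ennreal (\<rho> z) \<partial>lborel)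
      + ennreal M * ennreal (1 - exp (- S) - S * exp (- S))"
    unfolding nn_integral_truncated_exp_annulus[OF S y, symmetric]
    by (subst nn_integral_add) (simp_all add: nn_integral_cmult)
  also have "\<dots> \<le> ennreal (exp (- S)) * ennreal L + ennreal M * ennreal (1 - exp (- S) - S * exp (- S))"
    by (intro add_mono mult_left_mono mass) auto
  also have "\<dots> = ennreal (M * (1 - exp (- S)))"
  proof -
    have "(1 + S) * exp (- S) \<le> 1"
      using exp_ge_add_one_self[of S] by (simp add: exp_minus field_simps)
    then have "0 \<le> 1 - exp (- S) - S * exp (- S)" by (simp add: algebra_simps)
    then show ?thesis
      using L M by (simp flip: ennreal_mult ennreal_plus) (simp add: algebra_simps flip: MS)
  qed
  finally show ?thesis by (simp add: S_def)
qed

text \<open>The Gamma density of shape \<open>k + 1\<close> is the convolution of the exponential density with the one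
  of shape \<open>k\<close>, so the case \<open>k > 0\<close> is an average of translates of the case \<open>k = 0\<close>.\<close>

lemma gamma_moment_le:
  "(\<integral>\<^sup>+z. ennreal (\<rho> z * (exp (- (pi * (cmod z)\<^sup>2)) * (pi * (cmod z)\<^sup>2) ^ k / fact k)) \<partial>lborel)
     \<le> ennreal (M * (1 - exp (- (L / M))))"
proof (cases k)
  case 0
  then show ?thesis
    using exp_moment_le[of 0] nonneg by (simp add: ennreal_mult)
next
  \<comment> \<open>From here on \<open>k\<close> denotes the predecessor of the original index, so
    the target density carries the power \<open>Suc k\<close>.\<close>
  case (Suc k)
  define C where "C = M * (1 - exp (- (L / M)))"
  let ?p = "\<lambda>y. ennreal (y ^ k * exp (- y)) * indicator {0..} y :: ennreal"
  let ?T = "\<lambda>z y. ennreal (\<rho> z) * (ennreal (exp (- (pi * (cmod z)\<^sup>2 - y)))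
            * indicator {z. y \<le> pi * (cmod z)\<^sup>2} z)"
  \<comment> \<open>The Gamma density y^k exp(-y) / k! times the exponential density started at y.
    The factors exp(-y) and exp(y) cancel, leaving exp(-q) y^k / k! on [0, q], whose integral over y
    is the Gamma density with power k + 1.\<close>
  let ?f = "\<lambda>z y. ?p y * ?T z y * ennreal (1 / fact k)"
  have T[measurable]: "(\<lambda>(z, y). ?T z y) \<in> borel_measurable (lborel \<Otimes>\<^sub>M lborel)"
    unfolding indicator_def by measurable
  have [measurable]: "(\<lambda>(z, y). ?f z y) \<in> borel_measurable (lborel \<Otimes>\<^sub>M lborel)"
    using T unfolding indicator_def by measurable
  have "(\<integral>\<^sup>+z. ennreal (\<rho> z * (exp (- (pi * (cmod z)\<^sup>2)) * (pi * (cmod z)\<^sup>2) ^ Suc k / fact (Suc k))) \<partial>lborel)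
      = (\<integral>\<^sup>+z. (\<integral>\<^sup>+y. ?f z y \<partial>lborel) \<partial>lborel)"
  proof (intro nn_integral_cong)
    fix z :: complex
    define q where "q = pi * (cmod z)\<^sup>2"
    have q: "0 \<le> q" by (simp add: q_def)
    have "(\<integral>\<^sup>+y. ?f z y \<partial>lborel)
       = (\<integral>\<^sup>+y. ennreal (\<rho> z * exp (- q)) * (ennreal (y ^ k / fact k) * indicator {0..q} y) \<partial>lborel)"
    proof (intro nn_integral_cong)
      fix y :: real
      show "?f z y = ennreal (\<rho> z * exp (- q)) * (ennreal (y ^ k / fact k) * indicator {0..q} y)"
      proof (cases "0 \<le> y \<and> y \<le> q")
        case True
        then show ?thesis
          using nonneg[of z]
          by (simp add: q_def[symmetric] exp_diff exp_minus field_simps flip: ennreal_mult)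
      qed (auto simp: q_def indicator_def)
    qed
    also have "\<dots> = ennreal (\<rho> z * exp (- q) * (q ^ Suc k / fact (Suc k)))"
      using nonneg[of z] q
      by (subst nn_integral_cmult)
         (simp_all add: nn_integral_power_Icc[OF q] flip: ennreal_mult del: fact_Suc power_Suc)
    finally show "ennreal (\<rho> z * (exp (- (pi * (cmod z)\<^sup>2)) * (pi * (cmod z)\<^sup>2) ^ Suc k / fact (Suc k)))
        = (\<integral>\<^sup>+y. ?f z y \<partial>lborel)"
      by (simp add: q_def mult.assoc del: fact_Suc power_Suc)
  qed
  also have "\<dots> = (\<integral>\<^sup>+y. (\<integral>\<^sup>+z. ?f z y \<partial>lborel) \<partial>lborel)"
    by (rule lborel_pair.Fubini'[symmetric]) measurable
  \<comment> \<open>The bound \<open>C\<close> does not depend on the translation \<open>y\<close>,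
    so averaging over \<open>y\<close> against a probability density preserves it.\<close>
  also have "\<dots> \<le> (\<integral>\<^sup>+y. ?p y * (ennreal C * ennreal (1 / fact k)) \<partial>lborel)"
  proof (intro nn_integral_mono)
    fix y :: real
    show "(\<integral>\<^sup>+z. ?f z y \<partial>lborel) \<le> ?p y * (ennreal C * ennreal (1 / fact k))"
    proof (cases "0 \<le> y")
      case True
      have "(\<integral>\<^sup>+z. ?f z y \<partial>lborel) = ?p y * (\<integral>\<^sup>+z. ?T z y \<partial>lborel) * ennreal (1 / fact k)"
        by (simp add: nn_integral_cmult nn_integral_multc)
      also have "\<dots> \<le> ?p y * ennreal C * ennreal (1 / fact k)"
        using exp_moment_le[OF True] unfolding C_def by (intro mult_right_mono mult_left_mono) auto
      finally show ?thesis by (simp add: mult.assoc)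
    qed simp
  qed
  also have "\<dots> = ennreal (fact k) * (ennreal C * ennreal (1 / fact k))"
    using nn_intergal_power_times_exp_Ici[of k] by (simp add: nn_integral_multc)
  also have "\<dots> = ennreal C"
    by (simp add: mult.left_commute flip: ennreal_mult')
  finally show ?thesis by (simp add: Suc C_def)
qed

end

section \<open>Rotation invariance\<close>

lemma borel_measurable_Complex [measurable]:
  assumes [measurable]: "f \<in> borel_measurable M" "g \<in> borel_measurable M"
  shows "(\<lambda>x. Complex (f x) (g x)) \<in> borel_measurable M"
  unfolding Complex_eq by measurable

lemma borel_measurable_cnj [measurable]:
  assumes "f \<in> borel_measurable M"
  shows "(\<lambda>x. cnj (f x)) \<in> borel_measurable M"
  by (rule borel_measurable_continuous_on[OF _ assms]) (intro continuous_intros)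

lemma lborel_complex_eq_distr:
  "(lborel :: complex measure) = distr (lborel \<Otimes>\<^sub>M lborel) borel (\<lambda>(x, y). Complex x y)"
proof (rule lborel_eqI)
  fix l u :: complex
  assume le: "\<And>b. b \<in> Basis \<Longrightarrow> l \<bullet> b \<le> u \<bullet> b"
  have "Re l \<le> Re u" "Im l \<le> Im u"
    using le[of 1] le[of \<i>] by (auto simp: Basis_complex_def)
  moreover have "(\<lambda>(x, y). Complex x y) -` box l u \<inter> space (lborel \<Otimes>\<^sub>M lborel)
      = {Re l<..<Re u} \<times> {Im l<..<Im u}"
    by (auto simp: box_def Basis_complex_def space_pair_measure)
  ultimately show "emeasure (distr (lborel \<Otimes>\<^sub>M lborel) borel (\<lambda>(x, y). Complex x y)) (box l u)
      = ennreal (\<Prod>b\<in>Basis. (u - l) \<bullet> b)"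
    by (simp add: emeasure_distr lborel.emeasure_pair_measure_Times Basis_complex_def ennreal_mult
        complex_i_not_one[symmetric])
qed simp

lemma nn_integral_lborel_complex:
  fixes f :: "complex \<Rightarrow> ennreal"
  assumes [measurable]: "f \<in> borel_measurable borel"
  shows "(\<integral>\<^sup>+z. f z \<partial>lborel) = (\<integral>\<^sup>+x. \<integral>\<^sup>+y. f (Complex x y) \<partial>lborel \<partial>lborel)"
    and "(\<integral>\<^sup>+z. f z \<partial>lborel) = (\<integral>\<^sup>+y. \<integral>\<^sup>+x. f (Complex x y) \<partial>lborel \<partial>lborel)"
proof -
  have m: "(\<lambda>(x, y). f (Complex x y)) \<in> borel_measurable (lborel \<Otimes>\<^sub>M lborel)"
    by measurable
  show *: "(\<integral>\<^sup>+z. f z \<partial>lborel) = (\<integral>\<^sup>+x. \<integral>\<^sup>+y. f (Complex x y) \<partial>lborel \<partial>lborel)"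
    using lborel.nn_integral_fst[OF m]
    by (subst lborel_complex_eq_distr) (simp add: nn_integral_distr case_prod_beta')
  show "(\<integral>\<^sup>+z. f z \<partial>lborel) = (\<integral>\<^sup>+y. \<integral>\<^sup>+x. f (Complex x y) \<partial>lborel \<partial>lborel)"
    unfolding * using lborel_pair.Fubini'[OF m] by simp
qed

lemma nn_integral_lborel_shear:
  fixes f :: "complex \<Rightarrow> ennreal" and s :: real
  assumes [measurable]: "f \<in> borel_measurable borel"
  shows "(\<integral>\<^sup>+z. f (z + of_real (s * Im z)) \<partial>lborel) = (\<integral>\<^sup>+z. f z \<partial>lborel)"
    and "(\<integral>\<^sup>+z. f (z + \<i> * of_real (s * Re z)) \<partial>lborel) = (\<integral>\<^sup>+z. f z \<partial>lborel)"
proof -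
  have "(\<integral>\<^sup>+x. f (Complex x y + of_real (s * y)) \<partial>lborel) = (\<integral>\<^sup>+x. f (Complex x y) \<partial>lborel)" for y
    using nn_integral_real_affine[of "\<lambda>x. f (Complex x y)" 1 "s * y"]
    by (simp add: Complex_eq algebra_simps)
  then show "(\<integral>\<^sup>+z. f (z + of_real (s * Im z)) \<partial>lborel) = (\<integral>\<^sup>+z. f z \<partial>lborel)"
    by (simp add: nn_integral_lborel_complex(2))
  have "(\<integral>\<^sup>+y. f (Complex x y + \<i> * of_real (s * x)) \<partial>lborel) = (\<integral>\<^sup>+y. f (Complex x y) \<partial>lborel)" for x
    using nn_integral_real_affine[of "\<lambda>y. f (Complex x y)" 1 "s * x"]
    by (simp add: Complex_eq algebra_simps)
  then show "(\<integral>\<^sup>+z. f (z + \<i> * of_real (s * Re z)) \<partial>lborel) = (\<integral>\<^sup>+z. f z \<partial>lborel)"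
    by (simp add: nn_integral_lborel_complex(1))
qed

text \<open>A rotation is a product of three shears, which reduces its invariance to translation
  invariance on the line.\<close>

lemma nn_integral_lborel_rotate:
  fixes f :: "complex \<Rightarrow> ennreal" and u :: complex
  assumes f: "f \<in> borel_measurable borel" and u: "cmod u = 1"
  shows "(\<integral>\<^sup>+z. f (u * z) \<partial>lborel) = (\<integral>\<^sup>+z. f z \<partial>lborel)"
proof -
  have *: "(\<integral>\<^sup>+z. f (u * z) \<partial>lborel) = (\<integral>\<^sup>+z. f z \<partial>lborel)"
    if [measurable]: "f \<in> borel_measurable borel" and u: "cmod u = 1" and "Im u \<noteq> 0"
    for f :: "complex \<Rightarrow> ennreal" and u
  proof -
    \<comment> \<open>For u = cis \<theta> this is -tan(\<theta>/2), and the middle shear has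
      parameter sin \<theta>: the usual factorisation of a rotation into three shears.\<close>
    define t where "t = (Re u - 1) / Im u"
    define A where "A z = z + of_real (t * Im z)" for z
    define B where "B z = z + \<i> * of_real (Im u * Re z)" for z
    have [measurable]: "A \<in> borel_measurable borel" "B \<in> borel_measurable borel"
      unfolding A_def B_def by measurable
    have tu: "t * Im u = Re u - 1"
      using \<open>Im u \<noteq> 0\<close> by (simp add: t_def)
    have "(Re u)\<^sup>2 + (Im u)\<^sup>2 = 1"
      using u by (simp add: cmod_def)
    then have "t * (Re u + 1) = - Im u"
      using \<open>Im u \<noteq> 0\<close> by (simp add: t_def field_simps power2_eq_square)
    then have "t * Re u + t = - Im u"
      by (simp add: algebra_simps)
    then have "A (B (A z)) = u * z" for z
      using tu by (auto simp: A_def B_def complex_eq_iff) algebra+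
    then have "(\<integral>\<^sup>+z. f (u * z) \<partial>lborel) = (\<integral>\<^sup>+z. f (A (B (A z))) \<partial>lborel)" by simp
    also have "\<dots> = (\<integral>\<^sup>+z. f (A (B z)) \<partial>lborel)"
      using nn_integral_lborel_shear(1)[of "\<lambda>z. f (A (B z))" t] unfolding A_def[symmetric] by simp
    also have "\<dots> = (\<integral>\<^sup>+z. f (A z) \<partial>lborel)"
      using nn_integral_lborel_shear(2)[of "\<lambda>z. f (A z)" "Im u"] unfolding B_def[symmetric] by simp
    also have "\<dots> = (\<integral>\<^sup>+z. f z \<partial>lborel)"
      using nn_integral_lborel_shear(1)[of f t] unfolding A_def[symmetric] by simp
    finally show ?thesis .
  qed
  show ?thesis
  proof (cases "Im u = 0")
    \<comment> \<open>Here u is 1 or -1 and the shear parameter would divide by zero. Both \<i> and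
      -\<i> u have nonzero imaginary part, so two rotations of the previous kind compose to
      u.\<close>
    case True
    then have "Re u \<noteq> 0" using u by (auto simp: cmod_def)
    have "(\<integral>\<^sup>+z. f (u * z) \<partial>lborel) = (\<integral>\<^sup>+z. f (\<i> * ((- \<i> * u) * z)) \<partial>lborel)"
      by (simp add: algebra_simps)
    also have "\<dots> = (\<integral>\<^sup>+z. f (\<i> * z) \<partial>lborel)"
      using f u \<open>Re u \<noteq> 0\<close> by (intro *) (auto simp: norm_mult)
    also have "\<dots> = (\<integral>\<^sup>+z. f z \<partial>lborel)"
      using f by (intro *) auto
    finally show ?thesis .
  qed (use * f u in auto)
qed

lemma lborel_distr_rotate:
  assumes "cmod u = 1"
  shows "distr lborel borel ((*) u) = (lborel :: complex measure)"
proof (rule measure_eqI)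
  fix A assume "A \<in> sets (distr lborel borel ((*) u))"
  then have [measurable]: "A \<in> sets borel" by simp
  have "emeasure (distr lborel borel ((*) u)) A = (\<integral>\<^sup>+z. indicator A (u * z) \<partial>lborel)"
    using nn_integral_indicator[of A "distr lborel borel ((*) u)"]
    by (simp add: nn_integral_distr del: nn_integral_indicator)
  also have "\<dots> = emeasure lborel A"
    using assms by (subst nn_integral_lborel_rotate) simp_all
  finally show "emeasure (distr lborel borel ((*) u)) A = emeasure lborel A" .
qed simp

text \<open>Rotating by u multiplies the monomial by u^j (cnj u)^k and leaves \<open>W\<close>
  unchanged almost everywhere. With u chosen so that this factor is -1, the integral equals its own
  negative. The identities also cover the convention that a non-integrable function has integral
  0.\<close>

lemma radial_monomial_integral_eq_0:
  fixes W :: "complex \<Rightarrow> real"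
  assumes [measurable]: "W \<in> borel_measurable borel"
    and radial: "AE z in lborel. W z = w (cmod z)" and "j \<noteq> k"
  shows "(LINT z|lborel. of_real (W z) * (z ^ j * cnj z ^ k)) = 0"
proof -
  \<comment> \<open>The difference is taken in the reals, where it may be negative; the angle pi / n
    then makes the rotation factor cis pi = -1 for either sign.\<close>
  define n where "n = (of_nat j - of_nat k :: real)"
  define u where "u = cis (pi / n)"
  define I where "I = (LINT z|lborel. of_real (W z) * (z ^ j * cnj z ^ k))"
  have [simp]: "cmod u = 1" by (simp add: u_def)
  have n: "n \<noteq> 0" using \<open>j \<noteq> k\<close> by (simp add: n_def)
  have uu: "u ^ j * cnj u ^ k = -1"
  proof -
    have "u ^ j * cnj u ^ k = cis (real j * (pi / n) + real k * (- (pi / n)))"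
      by (simp only: u_def cis_cnj Complex.DeMoivre cis_mult)
    also have "real j * (pi / n) + real k * (- (pi / n)) = n * (pi / n)"
      unfolding n_def by (simp add: left_diff_distrib diff_divide_distrib)
    finally show ?thesis using n by simp
  qed
  have "AE z in lborel. W (u * z) = W z"
  proof -
    have "AE z in distr lborel borel ((*) u). W z = w (cmod z)"
      using radial unfolding lborel_distr_rotate[OF \<open>cmod u = 1\<close>] .
    then have "AE z in lborel. W (u * z) = w (cmod (u * z))"
      by (rule AE_distrD[rotated]) simp
    then show ?thesis
      using radial by eventually_elim (simp add: norm_mult)
  qed
  have "I = (LINT z|distr lborel borel ((*) u). of_real (W z) * (z ^ j * cnj z ^ k))"
    by (simp add: lborel_distr_rotate I_def)
  also have "\<dots> = (LINT z|lborel. of_real (W (u * z)) * ((u * z) ^ j * cnj (u * z) ^ k))"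
    by (subst integral_distr) auto
  also have "\<dots> = (LINT z|lborel. (u ^ j * cnj u ^ k) * (of_real (W z) * (z ^ j * cnj z ^ k)))"
    by (intro integral_cong_AE)
      (use \<open>AE z in lborel. W (u * z) = W z\<close> in \<open>auto simp: power_mult_distrib mult_ac elim: eventually_mono\<close>)
  also have "\<dots> = - I"
    unfolding integral_mult_right_zero I_def uu by simp
  finally show ?thesis by (simp add: I_def)
qed

section \<open>Hermite functions and the Bargmann kernel\<close>

text \<open>Zeros of a nontrivial power series are isolated, whereas the difference of the two
  series vanishes identically. The field is generic; the orthogonality argument uses it over the
  reals.\<close>

lemma powser_coeff_unique:
  fixes a b :: "nat \<Rightarrow> 'a::{real_normed_field, banach}"
  assumes "\<And>x. (\<lambda>n. a n * x ^ n) sums f x" "\<And>x. (\<lambda>n. b n * x ^ n) sums f x"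
  shows "a n = b n"
proof (rule ccontr)
  assume ne: "a n \<noteq> b n"
  define d where "d k = a k - b k" for k
  have d: "(\<lambda>k. d k * x ^ k) sums 0" for x
    using sums_diff[OF assms(1) assms(2), of x x] by (simp add: d_def left_diff_distrib)
  \<comment> \<open>The theorem on isolated zeros asks for a nonzero coefficient of positive index,
    so index 0 is settled by evaluating at 0.\<close>
  have "d 0 = 0"
    using d[of 0] by simp
  then have "n > 0" using ne by (cases n) (auto simp: d_def)
  have "d n \<noteq> 0" using ne by (simp add: d_def)
  show False
  proof (rule powser_0_nonzero[of 1 0 d "\<lambda>_. 0 :: 'a" n])
    fix s :: real
    assume "0 < s" and "\<And>z :: 'a. z \<in> cball 0 s - {0} \<Longrightarrow> (0::'a) \<noteq> 0"
    from this(2)[of "of_real s"] this(1) show False by simp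
  qed (use d \<open>d n \<noteq> 0\<close> \<open>n > 0\<close> in auto)
qed

text \<open>One integrable majorant \<open>E\<close> of all absolute partial sums gives
  integrability of each term, absolute convergence at each point and, after integration, a finite
  sum of the L^1 norms. These are the premises of \<open>sums_integral\<close>.\<close>

lemma sums_integral_dominated:
  fixes u :: "nat \<Rightarrow> 'a \<Rightarrow> 'b::{banach, second_countable_topology}"
  assumes [measurable]: "\<And>i. u i \<in> borel_measurable M" and E: "integrable M E"
    and bound: "\<And>n t. (\<Sum>i<n. norm (u i t)) \<le> E t"
    and s: "\<And>t. (\<lambda>i. u i t) sums S t"
  shows "(\<lambda>i. integral\<^sup>L M (u i)) sums integral\<^sup>L M S"
proof -
  have E0: "0 \<le> E t" for t using bound[where n = 0] by simp
  have i: "integrable M (u i)" for i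
  proof (rule Bochner_Integration.integrable_bound[OF E])
    have "norm (u i t) \<le> E t" for t
      using bound[where n = "Suc i" and t = t] sum_nonneg[of "{..<i}" "\<lambda>i. norm (u i t)"] by simp
    then show "AE t in M. norm (u i t) \<le> norm (E t)"
      using E0 by simp
  qed simp
  have sm: "summable (\<lambda>i. norm (u i t))" for t
    by (rule summableI_nonneg_bounded[where x = "E t"]) (use bound in auto)
  have sI: "summable (\<lambda>i. LINT t|M. norm (u i t))"
  proof (rule summableI_nonneg_bounded[where x = "integral\<^sup>L M E"])
    fix n
    have "(\<Sum>i<n. LINT t|M. norm (u i t)) = (LINT t|M. (\<Sum>i<n. norm (u i t)))"
      using i by (subst Bochner_Integration.integral_sum) auto
    also have "\<dots> \<le> integral\<^sup>L M E"
      using i E bound by (intro integral_mono) auto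
    finally show "(\<Sum>i<n. LINT t|M. norm (u i t)) \<le> integral\<^sup>L M E" .
  qed (simp add: integral_nonneg_AE)
  have eq: "(\<lambda>t. \<Sum>i. u i t) = S"
    using s by (auto simp: sums_iff)
  show "(\<lambda>i. integral\<^sup>L M (u i)) sums integral\<^sup>L M S"
    using sums_integral[OF i _ sI] sm by (simp add: eq)
qed

lemma integrable_mult_square_integrable:
  fixes f g :: "'a \<Rightarrow> 'b::{real_normed_algebra, banach, second_countable_topology}"
  assumes [measurable]: "f \<in> borel_measurable M" "g \<in> borel_measurable M"
    and "integrable M (\<lambda>t. (norm (f t))\<^sup>2)" "integrable M (\<lambda>t. (norm (g t))\<^sup>2)"
  shows "integrable M (\<lambda>t. f t * g t)"
proof (rule Bochner_Integration.integrable_bound)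
  show "integrable M (\<lambda>t. (norm (f t))\<^sup>2 + (norm (g t))\<^sup>2)" using assms by simp
  have "norm (f t * g t) \<le> (norm (f t))\<^sup>2 + (norm (g t))\<^sup>2" for t
    using norm_mult_ineq[of "f t" "g t"] sum_squares_bound[of "norm (f t)" "norm (g t)"]
      mult_nonneg_nonneg[OF norm_ge_zero norm_ge_zero, of "f t" "g t"] by linarith
  then show "AE t in M. norm (f t * g t) \<le> norm ((norm (f t))\<^sup>2 + (norm (g t))\<^sup>2)"
    by simp
qed simp

text \<open>The system is orthogonal with squared norms \<open>\<nu> k\<close>. If \<open>P\<close>
  is the projection of \<open>f\<close> on the first \<open>N\<close> members, both <f, P> and <P,
  P> equal the sum \<open>A\<close> on the left, so expanding the nonnegative integral of |f - P|^2
  leaves the squared norm of \<open>f\<close> minus \<open>A\<close>.\<close>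

lemma Bessel_inequality:
  fixes h :: "nat \<Rightarrow> 'a \<Rightarrow> real" and f :: "'a \<Rightarrow> complex"
  assumes [measurable]: "\<And>k. h k \<in> borel_measurable M" "f \<in> borel_measurable M"
    and h2: "\<And>k. integrable M (\<lambda>t. (h k t)\<^sup>2)" and f2: "integrable M (\<lambda>t. (cmod (f t))\<^sup>2)"
    and orth: "\<And>j k. (LINT t|M. h j t * h k t) = (if j = k then \<nu> k else 0)"
    and pos: "\<And>k. 0 < \<nu> k"
  shows "(\<Sum>k<N. (cmod (LINT t|M. f t * of_real (h k t)))\<^sup>2 / \<nu> k) \<le> (LINT t|M. (cmod (f t))\<^sup>2)"
proof -
  define c where "c k = (LINT t|M. f t * of_real (h k t))" for k
  define A where "A = (\<Sum>k<N. (cmod (c k))\<^sup>2 / \<nu> k)"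
  define P where "P t = (\<Sum>k<N. c k / of_real (\<nu> k) * of_real (h k t))" for t
  have [measurable]: "P \<in> borel_measurable M" unfolding P_def by measurable
  \<comment> \<open>Kept general in \<open>g\<close> because it is applied twice: to
    \<open>f\<close> itself and to each \<open>h j\<close>, the latter giving <P, P>.\<close>
  have int_P: "integrable M (\<lambda>t. g t * cnj (P t))"
      "(LINT t|M. g t * cnj (P t)) = (\<Sum>k<N. cnj (c k) / of_real (\<nu> k) * (LINT t|M. g t * of_real (h k t)))"
    if [measurable]: "g \<in> borel_measurable M" and g2: "integrable M (\<lambda>t. (cmod (g t))\<^sup>2)" for g
  proof -
    have gh: "integrable M (\<lambda>t. g t * of_real (h k t))" for k
      by (rule integrable_mult_square_integrable) (use h2 g2 in auto)
    have eq: "g t * cnj (P t) = (\<Sum>k<N. cnj (c k) / of_real (\<nu> k) * (g t * of_real (h k t)))" for t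
      by (simp add: P_def sum_distrib_left mult_ac)
    show "integrable M (\<lambda>t. g t * cnj (P t))"
      unfolding eq using gh by (intro Bochner_Integration.integrable_sum integrable_mult_right)
    show "(LINT t|M. g t * cnj (P t)) = (\<Sum>k<N. cnj (c k) / of_real (\<nu> k) * (LINT t|M. g t * of_real (h k t)))"
      unfolding eq using gh
      by (subst Bochner_Integration.integral_sum) (auto intro: integrable_mult_right simp del: times_divide_eq_left)
  qed
  have A_eq: "(\<Sum>k<N. cnj (c k) / of_real (\<nu> k) * c k) = of_real A"
    unfolding A_def of_real_sum
    by (intro sum.cong) (auto simp: complex_norm_square mult.commute simp del: of_real_power)
  have fP: "integrable M (\<lambda>t. f t * cnj (P t))" and IfP: "(LINT t|M. f t * cnj (P t)) = of_real A"
    using int_P[of f] f2 A_eq by (simp_all add: c_def)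
  have hP: "integrable M (\<lambda>t. of_real (h j t) * cnj (P t))" for j
    using int_P(1)[of "\<lambda>t. of_real (h j t)"] h2 by simp
  have IhP: "(LINT t|M. of_real (h j t) * cnj (P t)) = cnj (c j)" if "j < N" for j
  proof -
    have "(LINT t|M. complex_of_real (h j t) * of_real (h k t)) = of_real (if j = k then \<nu> k else 0)" for k
      unfolding orth[symmetric] by (simp flip: integral_complex_of_real)
    then have "(LINT t|M. of_real (h j t) * cnj (P t))
        = (\<Sum>k<N. cnj (c k) / of_real (\<nu> k) * of_real (if j = k then \<nu> k else 0))"
      using int_P(2)[of "\<lambda>t. of_real (h j t)"] h2 by simp
    also have "\<dots> = (\<Sum>k<N. if k = j then cnj (c j) else 0)"
      using pos by (intro sum.cong) (auto simp: less_imp_neq[THEN not_sym])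
    finally show ?thesis using that by simp
  qed
  have eq2: "P t * cnj (P t) = (\<Sum>j<N. c j / of_real (\<nu> j) * (of_real (h j t) * cnj (P t)))" for t
    by (subst (1) P_def) (simp add: sum_distrib_right sum_distrib_left mult_ac)
  have PP: "integrable M (\<lambda>t. P t * cnj (P t))"
    unfolding eq2 using hP by (intro Bochner_Integration.integrable_sum integrable_mult_right)
  have "(LINT t|M. P t * cnj (P t)) = (\<Sum>j<N. c j / of_real (\<nu> j) * (LINT t|M. of_real (h j t) * cnj (P t)))"
    unfolding eq2 using hP
    by (subst Bochner_Integration.integral_sum) (auto intro: integrable_mult_right simp del: times_divide_eq_left)
  also have "\<dots> = of_real A"
    unfolding A_eq[symmetric] by (intro sum.cong) (simp_all add: IhP)
  finally have IPP: "(LINT t|M. P t * cnj (P t)) = of_real A" .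
  have eq3: "(cmod (f t - P t))\<^sup>2 = (cmod (f t))\<^sup>2 - 2 * Re (f t * cnj (P t)) + Re (P t * cnj (P t))" for t
    unfolding cmod_power2 by (simp add: power2_eq_square algebra_simps)
  have "0 \<le> (LINT t|M. (cmod (f t - P t))\<^sup>2)" by simp
  also have "\<dots> = (LINT t|M. (cmod (f t))\<^sup>2) - 2 * Re (LINT t|M. f t * cnj (P t)) + Re (LINT t|M. P t * cnj (P t))"
    unfolding eq3 using f2 fP PP by (simp del: times_complex.simps complex_cnj)
  also have "\<dots> = (LINT t|M. (cmod (f t))\<^sup>2) - A"
    by (simp add: IfP IPP)
  finally show ?thesis by (simp add: A_def c_def)
qed

text \<open>Taylor coefficients at 0 of w \<mapsto> exp(- pi w^2 / 2).\<close>

definition gauss_coeff :: "nat \<Rightarrow> real" where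
  "gauss_coeff m = (if even m then (- pi / 2) ^ (m div 2) / fact (m div 2) else 0)"

text \<open>Hermite functions, scaled so that their generating function is the Bargmann kernel.\<close>

definition hermite_fun :: "nat \<Rightarrow> real \<Rightarrow> real" where
  "hermite_fun k t = 2 powr (1/4) * exp (- pi * t\<^sup>2)
     * (\<Sum>i\<le>k. (2 * pi * t) ^ i / fact i * gauss_coeff (k - i))"

text \<open>The type is generic because both instances occur: real parameters for the Gaussian
  integrals behind orthogonality, complex ones for the Gabor transform.\<close>

definition bargmann_kernel :: "'a::{real_normed_field, banach} \<Rightarrow> real \<Rightarrow> 'a" where
  "bargmann_kernel w t = of_real (2 powr (1/4)) * exp (of_real (2 * pi * t) * w - of_real (pi * t\<^sup>2) - of_real (pi / 2) * w\<^sup>2)"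

text \<open>The kernel series with every Taylor term replaced by its absolute value at |w| = r. This
  turns the quadratic exponent from - pi w^2 / 2 into + pi r^2 / 2.\<close>

definition hermite_majorant :: "real \<Rightarrow> real \<Rightarrow> real" where
  "hermite_majorant r t = 2 powr (1/4) * exp (- pi * t\<^sup>2) * (exp (2 * pi * \<bar>t\<bar> * r) * exp (pi / 2 * r\<^sup>2))"

lemma gauss_coeff_sums:
  fixes w :: "'a::{real_normed_field, banach}"
  shows "(\<lambda>m. of_real (gauss_coeff m) * w ^ m) sums exp (of_real (- pi / 2) * w\<^sup>2)"
    and "(\<lambda>m. norm (of_real (gauss_coeff m) * w ^ m)) sums exp (pi / 2 * (norm w)\<^sup>2)"
proof -
  have sm: "strict_mono (\<lambda>n. 2 * n :: nat)" by (simp add: strict_mono_def)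
  have z: "gauss_coeff m = 0" if "m \<notin> range (\<lambda>n. 2 * n)" for m
    using that by (auto simp: gauss_coeff_def elim!: evenE)
  have *: "(of_real c * x) ^ n /\<^sub>R fact n = of_real (c ^ n / fact n) * x ^ n" for c n and x :: 'a
    by (simp add: scaleR_conv_of_real power_mult_distrib field_simps)
  have "(\<lambda>n. of_real (gauss_coeff (2 * n)) * w ^ (2 * n)) sums exp (of_real (- pi / 2) * w\<^sup>2)"
    using exp_converges[of "of_real (- pi / 2) * w\<^sup>2"] unfolding *
    by (simp add: gauss_coeff_def power_mult)
  then show "(\<lambda>m. of_real (gauss_coeff m) * w ^ m) sums exp (of_real (- pi / 2) * w\<^sup>2)"
    by (subst (asm) sums_mono_reindex[OF sm, of "\<lambda>m. of_real (gauss_coeff m) * w ^ m"]) (auto simp: z)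
  have "norm (of_real (gauss_coeff (2 * n)) * w ^ (2 * n)) = (pi / 2 * (norm w)\<^sup>2) ^ n /\<^sub>R fact n" for n
    unfolding norm_mult norm_of_real norm_power
    by (simp add: gauss_coeff_def power_abs power_mult_distrib field_simps flip: power_mult)
  then have "(\<lambda>n. norm (of_real (gauss_coeff (2 * n)) * w ^ (2 * n))) sums exp (pi / 2 * (norm w)\<^sup>2)"
    using exp_converges[of "pi / 2 * (norm w)\<^sup>2"] by (simp del: norm_mult)
  then show "(\<lambda>m. norm (of_real (gauss_coeff m) * w ^ m)) sums exp (pi / 2 * (norm w)\<^sup>2)"
    by (subst (asm) sums_mono_reindex[OF sm, of "\<lambda>m. norm (of_real (gauss_coeff m) * w ^ m)"]) (auto simp: z)
qed

text \<open>\<open>hermite_fun\<close> is, up to the Gaussian factor, the Cauchy convolution of the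
  Taylor coefficients of exp(2 pi t w) and exp(- pi w^2 / 2), so the kernel is the Cauchy product.
  Multiplying the two series of norms instead yields the majorant.\<close>

lemma hermite_fun_sums:
  fixes w :: "'a::{real_normed_field, banach}"
  shows "(\<lambda>k. of_real (hermite_fun k t) * w ^ k) sums bargmann_kernel w t"
    and "(\<Sum>k<n. norm (of_real (hermite_fun k t) * w ^ k)) \<le> hermite_majorant (norm w) t"
proof -
  define a where "a i = of_real ((2 * pi * t) ^ i / fact i) * w ^ i" for i
  define b where "b m = of_real (gauss_coeff m) * w ^ m" for m
  define K where "K = 2 powr (1/4) * exp (- pi * t\<^sup>2)"
  have K: "K \<ge> 0" by (simp add: K_def)
  have a1: "a sums exp (of_real (2 * pi * t) * w)"
    using exp_converges[of "of_real (2 * pi * t) * w"]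
    by (simp add: a_def[abs_def] scaleR_conv_of_real power_mult_distrib field_simps)
  have a2: "(\<lambda>i. norm (a i)) sums exp (2 * pi * \<bar>t\<bar> * norm w)"
    using exp_converges[of "2 * pi * \<bar>t\<bar> * norm w"]
    by (simp add: a_def[abs_def] norm_mult norm_power norm_divide power_abs abs_mult power_mult_distrib field_simps)
  note b1 = gauss_coeff_sums(1)[of w, folded b_def] and b2 = gauss_coeff_sums(2)[of w, folded b_def]
  have conv: "of_real (hermite_fun k t) * w ^ k = of_real K * (\<Sum>i\<le>k. a i * b (k - i))" for k
  proof -
    have "a i * b (k - i) = of_real ((2 * pi * t) ^ i / fact i * gauss_coeff (k - i)) * w ^ k" if "i \<le> k" for i
      using that by (simp add: a_def b_def mult_ac flip: power_add)
    then show ?thesis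
      by (simp add: hermite_fun_def K_def sum_distrib_right sum_distrib_left mult_ac)
  qed
  have "(\<lambda>k. \<Sum>i\<le>k. a i * b (k - i)) sums (exp (of_real (2 * pi * t) * w) * exp (of_real (- pi / 2) * w\<^sup>2))"
    using Cauchy_product_sums[of a b] a1 a2 b1 b2 by (simp add: sums_iff)
  from sums_mult[OF this, of "of_real K"]
  show "(\<lambda>k. of_real (hermite_fun k t) * w ^ k) sums bargmann_kernel w t"
    unfolding conv
    by (simp add: K_def bargmann_kernel_def exp_of_real[symmetric] mult_ac flip: exp_add)
       (simp add: algebra_simps)
  have "(\<lambda>k. \<Sum>i\<le>k. norm (a i) * norm (b (k - i))) sums
      (exp (2 * pi * \<bar>t\<bar> * norm w) * exp (pi / 2 * (norm w)\<^sup>2))"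
    using Cauchy_product_sums[of "\<lambda>i. norm (a i)" "\<lambda>i. norm (b i)"] a2 b2 by (simp add: sums_iff)
  from sums_mult[OF this, of K]
  have s: "(\<lambda>k. K * (\<Sum>i\<le>k. norm (a i) * norm (b (k - i)))) sums hermite_majorant (norm w) t"
    by (simp add: K_def hermite_majorant_def)
  have "(\<Sum>k<n. norm (of_real (hermite_fun k t) * w ^ k))
      \<le> (\<Sum>k<n. K * (\<Sum>i\<le>k. norm (a i) * norm (b (k - i))))"
  proof (intro sum_mono)
    fix k
    have "norm (\<Sum>i\<le>k. a i * b (k - i)) \<le> (\<Sum>i\<le>k. norm (a i) * norm (b (k - i)))"
      by (intro sum_norm_le) (simp add: norm_mult)
    then show "norm (of_real (hermite_fun k t) * w ^ k) \<le> K * (\<Sum>i\<le>k. norm (a i) * norm (b (k - i)))"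
      unfolding conv norm_mult norm_of_real using K by (simp add: mult_left_mono)
  qed
  also have "\<dots> \<le> hermite_majorant (norm w) t"
    unfolding sums_unique[OF s]
    using s K by (intro sum_le_suminf) (auto intro!: mult_nonneg_nonneg sum_nonneg simp: sums_iff)
  finally show "(\<Sum>k<n. norm (of_real (hermite_fun k t) * w ^ k)) \<le> hermite_majorant (norm w) t" .
qed

section \<open>Gaussian integrals and orthogonality of the Hermite functions\<close>

lemma borel_measurable_hermite_fun [measurable]: "hermite_fun k \<in> borel_measurable borel"
  unfolding hermite_fun_def by measurable

lemma borel_measurable_hermite_majorant [measurable]: "hermite_majorant r \<in> borel_measurable borel"
  unfolding hermite_majorant_def by measurable

lemma borel_measurable_bargmann_kernel [measurable]:
  "bargmann_kernel (w::'a::{real_normed_field, banach, second_countable_topology}) \<in> borel_measurable borel"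
  unfolding bargmann_kernel_def by (intro borel_measurable_continuous_onI continuous_intros)

text \<open>Completing the square in t turns the product into exp(pi r s) times the normal density
  with mean (r + s) / 2 and deviation 1 / (2 sqrt pi). The expansion of exp(pi r s) contains only
  the powers (r s)^k, which is the source of orthogonality.\<close>

lemma bargmann_kernel_gram:
  "has_bochner_integral lborel (\<lambda>t. bargmann_kernel r t * bargmann_kernel s t) (exp (pi * r * s))"
  for r s :: real
proof -
  have "sqrt 2 * exp (- 2 * pi * (t - (r + s) / 2)\<^sup>2) = normal_density ((r + s) / 2) (1 / (2 * sqrt pi)) t" for t
    by (simp add: normal_density_def power_divide power_mult_distrib real_sqrt_divide field_simps)
  moreover have "bargmann_kernel r t * bargmann_kernel s t
      = exp (pi * r * s) * (sqrt 2 * exp (- 2 * pi * (t - (r + s) / 2)\<^sup>2))" for t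
  proof -
    have "2 powr (1/4) * 2 powr (1/4) = sqrt (2::real)"
      by (simp add: powr_half_sqrt flip: powr_add)
    moreover have "(2 * pi * t * r - pi * t\<^sup>2 - pi / 2 * r\<^sup>2) + (2 * pi * t * s - pi * t\<^sup>2 - pi / 2 * s\<^sup>2)
      = pi * r * s + - 2 * pi * (t - (r + s) / 2)\<^sup>2"
      by (simp add: power2_eq_square field_simps)
    ultimately show ?thesis
      unfolding bargmann_kernel_def
      by (simp add: mult_ac flip: exp_add)
  qed
  ultimately have eq: "bargmann_kernel r t * bargmann_kernel s t
      = exp (pi * r * s) * normal_density ((r + s) / 2) (1 / (2 * sqrt pi)) t" for t
    by simp
  have "has_bochner_integral lborel (normal_density ((r + s) / 2) (1 / (2 * sqrt pi))) 1"
    by (simp add: has_bochner_integral_iff)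
  from has_bochner_integral_mult_right[OF this, of "exp (pi * r * s)"]
  show ?thesis by (simp add: eq)
qed

text \<open>Since |t| r equals t r or t (-r), the majorant is exp(pi r^2) times the kernel at r or
  -r according to the sign of t. Its square is thus dominated by two Gram integrands.\<close>

lemma hermite_majorant_square_integrable:
  assumes "0 \<le> r"
  shows "integrable lborel (\<lambda>t. (hermite_majorant r t)\<^sup>2)"
proof (rule Bochner_Integration.integrable_bound)
  let ?B = "\<lambda>t. (exp (pi * r\<^sup>2))\<^sup>2 * (bargmann_kernel r t * bargmann_kernel r t
      + bargmann_kernel (- r) t * bargmann_kernel (- r) t)"
  show "integrable lborel ?B"
    using bargmann_kernel_gram by (intro integrable_mult_right Bochner_Integration.integrable_add) (auto simp: has_bochner_integral_iff)
  have "(hermite_majorant r t)\<^sup>2 \<le> ?B t" for t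
  proof -
    have "hermite_majorant r t = exp (pi * r\<^sup>2) * bargmann_kernel (if 0 \<le> t then r else - r) t"
      unfolding hermite_majorant_def bargmann_kernel_def
      by (auto simp: mult_ac simp flip: exp_add)
    then show ?thesis
      by (auto simp: power_mult_distrib power2_eq_square)
  qed
  then show "AE t in lborel. norm ((hermite_majorant r t)\<^sup>2) \<le> norm (?B t)"
    by (intro AE_I2) (auto intro: order_trans)
qed simp

text \<open>Termwise integration of the generating function against \<open>f\<close>, dominated by
  |f| times the majorant, a product of two square integrable functions. The coefficients of the
  transform are the Hermite coefficients of \<open>f\<close>.\<close>

lemma bargmann_kernel_expansion:
  fixes f :: "real \<Rightarrow> 'a::{real_normed_field, banach, second_countable_topology}"
  assumes [measurable]: "f \<in> borel_measurable borel" and f2: "integrable lborel (\<lambda>t. (norm (f t))\<^sup>2)"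
  shows "(\<lambda>k. (LINT t|lborel. f t * of_real (hermite_fun k t)) * w ^ k) sums
           (LINT t|lborel. f t * bargmann_kernel w t)"
proof -
  let ?u = "\<lambda>k t. f t * of_real (hermite_fun k t) * w ^ k"
  let ?E = "\<lambda>t. norm (f t) * hermite_majorant (norm w) t"
  have "integrable lborel ?E"
    using f2 hermite_majorant_square_integrable[of "norm w"]
    by (intro integrable_mult_square_integrable) auto
  moreover have "(\<Sum>k<n. norm (?u k t)) \<le> ?E t" for n t
  proof -
    have "(\<Sum>k<n. norm (?u k t)) = norm (f t) * (\<Sum>k<n. norm (of_real (hermite_fun k t) * w ^ k))"
      by (simp add: norm_mult sum_distrib_left mult_ac)
    then show ?thesis
      by (simp only: mult_left_mono[OF hermite_fun_sums(2)] norm_ge_zero)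
  qed
  moreover have "(\<lambda>k. ?u k t) sums (f t * bargmann_kernel w t)" for t
    using sums_mult[OF hermite_fun_sums(1), of "f t"] by (simp add: mult.assoc)
  ultimately have "(\<lambda>k. LINT t|lborel. ?u k t) sums (LINT t|lborel. f t * bargmann_kernel w t)"
    by (intro sums_integral_dominated[where E = ?E]) auto
  then show ?thesis by simp
qed

text \<open>At w = 1 a single term of the generating series is already bounded by the
  majorant.\<close>

lemma hermite_fun_square_integrable: "integrable lborel (\<lambda>t. (hermite_fun k t)\<^sup>2)"
proof (rule Bochner_Integration.integrable_bound)
  show "integrable lborel (\<lambda>t. (hermite_majorant 1 t)\<^sup>2)"
    by (simp add: hermite_majorant_square_integrable)
  have "\<bar>hermite_fun k t\<bar> \<le> hermite_majorant 1 t" for t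
  proof -
    have "(\<Sum>i<k. \<bar>hermite_fun i t\<bar>) + \<bar>hermite_fun k t\<bar> \<le> hermite_majorant 1 t"
      using hermite_fun_sums(2)[where n = "Suc k" and t = t and w = "1::real"] by simp
    moreover have "0 \<le> (\<Sum>i<k. \<bar>hermite_fun i t\<bar>)" by (simp add: sum_nonneg)
    ultimately show ?thesis by linarith
  qed
  then show "AE t in lborel. norm ((hermite_fun k t)\<^sup>2) \<le> norm ((hermite_majorant 1 t)\<^sup>2)"
    by (intro AE_I2) (simp add: order_trans[OF _ abs_ge_self] flip: abs_le_square_iff)
qed simp

text \<open>Coefficients are compared twice. Expanding exp(pi r s) in s identifies the pairing of
  the kernel at r with \<open>hermite_fun k\<close> as (pi r)^k / k!; expanding that pairing in r
  leaves a single nonzero coefficient.\<close>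

lemma hermite_fun_orthogonal:
  "(LINT t|lborel. hermite_fun j t * hermite_fun k t) = (if j = k then pi ^ k / fact k else 0)"
proof -
  have b2: "integrable lborel (\<lambda>t. (norm (bargmann_kernel r t))\<^sup>2)" for r :: real
    using bargmann_kernel_gram[of r r] by (simp add: has_bochner_integral_iff power2_eq_square)
  have bh: "(LINT t|lborel. bargmann_kernel r t * hermite_fun k t) = (pi * r) ^ k / fact k" for r k
  proof (rule powser_coeff_unique[of "\<lambda>k. LINT t|lborel. bargmann_kernel r t * hermite_fun k t"
        "\<lambda>s. exp (pi * r * s)" "\<lambda>k. (pi * r) ^ k / fact k"])
    fix s :: real
    show "(\<lambda>k. (LINT t|lborel. bargmann_kernel r t * hermite_fun k t) * s ^ k) sums exp (pi * r * s)"
      using bargmann_kernel_expansion[OF _ b2, of r s] bargmann_kernel_gram[of r s]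
      by (simp add: has_bochner_integral_iff)
    show "(\<lambda>k. (pi * r) ^ k / fact k * s ^ k) sums exp (pi * r * s)"
      using exp_converges[of "pi * r * s"] by (simp add: power_mult_distrib field_simps)
  qed
  have "(LINT t|lborel. hermite_fun k t * hermite_fun j t) = (if j = k then pi ^ k / fact k else 0)"
  proof (rule powser_coeff_unique[of "\<lambda>j. LINT t|lborel. hermite_fun k t * hermite_fun j t"
        "\<lambda>r. (pi * r) ^ k / fact k" "\<lambda>j. if j = k then pi ^ k / fact k else 0"])
    fix r :: real
    show "(\<lambda>j. (LINT t|lborel. hermite_fun k t * hermite_fun j t) * r ^ j) sums ((pi * r) ^ k / fact k)"
      using bargmann_kernel_expansion[of "hermite_fun k" r] hermite_fun_square_integrable[of k] bh[of r k]
      by (simp add: mult.commute)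
    have "(\<lambda>j. if j = k then pi ^ k / fact k * r ^ j else 0) sums (pi ^ k / fact k * r ^ k)"
      by (rule sums_single)
    then show "(\<lambda>j. (if j = k then pi ^ k / fact k else 0) * r ^ j) sums ((pi * r) ^ k / fact k)"
      by (simp add: power_mult_distrib if_distrib[of "\<lambda>x. x * _"] cong: if_cong)
  qed
  then show ?thesis by (simp add: mult.commute)
qed

lemma hermite_coeff_Bessel:
  assumes "f \<in> borel_measurable borel" "integrable lborel (\<lambda>t. (cmod (f t))\<^sup>2)"
  shows "(\<Sum>k<N. (cmod (LINT t|lborel. f t * of_real (hermite_fun k t)))\<^sup>2 / (pi ^ k / fact k))
      \<le> (LINT t|lborel. (cmod (f t))\<^sup>2)"
  by (rule Bessel_inequality)
    (use assms in \<open>auto simp: hermite_fun_square_integrable hermite_fun_orthogonal\<close>)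

section \<open>The short-time Fourier transform with Gaussian window\<close>

text \<open>On the disc carrying \<open>W\<close> both power series converge absolutely and
  uniformly, so each may be integrated term by term. Rotation invariance then leaves only the
  products of equal powers.\<close>

lemma radial_power_series_pairing:
  fixes W :: "complex \<Rightarrow> real" and c d :: "nat \<Rightarrow> complex"
  assumes W: "integrable lborel W" and [measurable]: "W \<in> borel_measurable borel"
    and supp: "\<And>z. R < cmod z \<Longrightarrow> W z = 0"
    and radial: "AE z in lborel. W z = w (cmod z)"
    and c: "\<And>z. (\<lambda>k. c k * z ^ k) sums P z" and d: "\<And>z. (\<lambda>k. d k * z ^ k) sums Q z"
  shows "(\<lambda>k. c k * cnj (d k) * of_real (LINT z|lborel. W z * (cmod z) ^ (2 * k))) sums
      (LINT z|lborel. of_real (W z) * (P z * cnj (Q z)))"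
proof -
  \<comment> \<open>\<open>R\<close> may be negative, whereas the bounds below need a genuine
    radius.\<close>
  define R' where "R' = max 0 R"
  have R': "0 \<le> R'" by (simp add: R'_def)
  have supp': "W z \<noteq> 0 \<Longrightarrow> cmod z \<le> R'" for z using supp[of z] by (auto simp: R'_def not_less[symmetric])
  \<comment> \<open>A uniform bound for the series on the disc. It is finite because convergence at
    R' + 1 forces absolute convergence at R'.\<close>
  define S where "S a = (\<Sum>k. cmod (a k) * R' ^ k)" for a :: "nat \<Rightarrow> complex"
  have partial: "(\<Sum>k<n. cmod (a k) * R' ^ k) \<le> S a" 
    if "\<And>z. (\<lambda>k. a k * z ^ k) sums A z" for a A n
  proof -
    have "summable (\<lambda>k. norm (a k * of_real R' ^ k))"
      using that[of "of_real (R' + 1)"] R' by (intro powser_insidea[of _ "of_real (R' + 1)"]) (auto simp: sums_iff)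
    then show ?thesis
      using R' unfolding S_def by (intro sum_le_suminf) (auto simp: norm_mult norm_power)
  qed
  have meas: "A \<in> borel_measurable borel"
    if a: "\<And>z. (\<lambda>k. a k * z ^ k) sums A z" for a :: "nat \<Rightarrow> complex" and A
  proof (rule borel_measurable_LIMSEQ_metric)
    show "(\<lambda>z. \<Sum>k<n. a k * z ^ k) \<in> borel_measurable borel" for n by measurable
    show "(\<lambda>n. \<Sum>k<n. a k * z ^ k) \<longlonglongrightarrow> A z" for z
      using a[of z] by (simp add: sums_def)
  qed
  note [measurable] = meas[OF c] meas[OF d]
  have bound: "(\<Sum>k<n. cmod (a k) * cmod z ^ k) \<le> S a" 
    if a: "\<And>z. (\<lambda>k. a k * z ^ k) sums A z" and "cmod z \<le> R'" for a A n z
    by (rule order_trans[OF sum_mono partial[OF a]])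
      (use that in \<open>auto intro!: mult_left_mono power_mono\<close>)
  have Qb: "cmod (Q z) \<le> S d" if "cmod z \<le> R'" for z
  proof (rule LIMSEQ_le_const2)
    show "(\<lambda>n. cmod (\<Sum>k<n. d k * z ^ k)) \<longlonglongrightarrow> cmod (Q z)"
      using d unfolding sums_def by (intro tendsto_norm)
    show "\<exists>N. \<forall>n\<ge>N. cmod (\<Sum>k<n. d k * z ^ k) \<le> S d"
      using bound[OF d that] by (intro exI allI impI order_trans[OF norm_sum]) (simp add: norm_mult norm_power)
  qed
  have S0: "0 \<le> S a" if "\<And>z. (\<lambda>k. a k * z ^ k) sums A z" for a A
    using partial[OF that, of 0] by simp
  note Sc = S0[OF c] and Sd = S0[OF d]
  \<comment> \<open>Only \<open>Q\<close> is expanded here, against one fixed monomial, so a single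
    series survives as its term k = j; \<open>P\<close> is expanded afterwards. This avoids a double
    series.\<close>
  have inner: "(LINT z|lborel. of_real (W z) * (z ^ j * cnj (Q z)))
      = cnj (d j) * of_real (LINT z|lborel. W z * (cmod z) ^ (2 * j))" for j
  proof -
    let ?u = "\<lambda>k z. cnj (d k) * (of_real (W z) * (z ^ j * cnj z ^ k))"
    have "(\<Sum>k<n. norm (?u k z)) \<le> \<bar>W z\<bar> * (R' ^ j * S d)" for n z
    proof (cases "W z = 0")
      case False
      then have z: "cmod z \<le> R'" by (rule supp')
      have "(\<Sum>k<n. norm (?u k z)) = \<bar>W z\<bar> * (cmod z ^ j * (\<Sum>k<n. cmod (d k) * cmod z ^ k))"
        by (simp add: norm_mult norm_power sum_distrib_left mult_ac)
      also have "\<dots> \<le> \<bar>W z\<bar> * (R' ^ j * S d)"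
        using bound[OF d z] z R'
        by (intro mult_left_mono mult_mono power_mono) (auto intro!: sum_nonneg)
      finally show ?thesis .
    qed simp
    moreover have "(\<lambda>k. ?u k z) sums (of_real (W z) * (z ^ j * cnj (Q z)))" for z
    proof -
      have "(\<lambda>k. cnj (d k * z ^ k)) sums cnj (Q z)"
        using d[of z] by (simp only: sums_cnj)
      from sums_mult[OF this, of "of_real (W z) * z ^ j"] show ?thesis
        by (simp add: mult_ac)
    qed
    ultimately have "(\<lambda>k. LINT z|lborel. ?u k z) sums (LINT z|lborel. of_real (W z) * (z ^ j * cnj (Q z)))"
      using W by (intro sums_integral_dominated[where E = "\<lambda>z. \<bar>W z\<bar> * (R' ^ j * S d)"]) auto
    moreover have "(LINT z|lborel. ?u k z)
        = (if k = j then cnj (d j) * of_real (LINT z|lborel. W z * (cmod z) ^ (2 * j)) else 0)" for k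
    proof (cases "k = j")
      case True
      have "z * cnj z = (complex_of_real (cmod z))\<^sup>2" for z
        using complex_norm_square[of z] by simp
      then have "of_real (W z) * (z ^ j * cnj z ^ j) = complex_of_real (W z * (cmod z) ^ (2 * j))" for z
        by (simp add: power_mult flip: power_mult_distrib)
      then show ?thesis
        using True by (simp only: integral_mult_right_zero integral_complex_of_real simp_thms if_True)
    next
      case False
      then show ?thesis
        using radial_monomial_integral_eq_0[OF _ radial, of j k] by simp
    qed
    ultimately have "(\<lambda>k. if k = j then cnj (d j) * of_real (LINT z|lborel. W z * (cmod z) ^ (2 * j)) else 0)
        sums (LINT z|lborel. of_real (W z) * (z ^ j * cnj (Q z)))" by simp
    then show ?thesis
      using sums_single[of j "\<lambda>k. cnj (d j) * of_real (LINT z|lborel. W z * (cmod z) ^ (2 * j))"]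
        sums_unique2 by blast
  qed
  let ?v = "\<lambda>j z. c j * (of_real (W z) * (z ^ j * cnj (Q z)))"
  have "(\<Sum>j<n. norm (?v j z)) \<le> \<bar>W z\<bar> * (S c * S d)" for n z
  proof (cases "W z = 0")
    case False
    then have z: "cmod z \<le> R'" by (rule supp')
    have "(\<Sum>j<n. norm (?v j z)) = \<bar>W z\<bar> * ((\<Sum>j<n. cmod (c j) * cmod z ^ j) * cmod (Q z))"
      by (simp add: norm_mult norm_power sum_distrib_left sum_distrib_right mult_ac)
    also have "\<dots> \<le> \<bar>W z\<bar> * (S c * S d)"
      using bound[OF c z] Qb[OF z] Sc by (intro mult_left_mono mult_mono) auto
    finally show ?thesis .
  qed simp
  moreover have "(\<lambda>j. ?v j z) sums (of_real (W z) * (P z * cnj (Q z)))" for z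
    using sums_mult[OF c[of z], of "of_real (W z) * cnj (Q z)"] by (simp add: mult_ac)
  ultimately have "(\<lambda>j. LINT z|lborel. ?v j z) sums (LINT z|lborel. of_real (W z) * (P z * cnj (Q z)))"
    using W by (intro sums_integral_dominated[where E = "\<lambda>z. \<bar>W z\<bar> * (S c * S d)"]) auto
  then show ?thesis
    by (simp only: integral_mult_right_zero inner mult.assoc)
qed

section \<open>The Gabor transform of Borel functions and its Bargmann form\<close>

definition gabor :: "(real \<Rightarrow> complex) \<Rightarrow> complex \<Rightarrow> complex" where
  "gabor f z = (LINT t|lborel. f t * cnj (tf_shift z gauss_window t))"

text \<open>A Borel version of \<open>L2_real\<close>: the Fubini arguments run over
  \<open>lborel\<close>, and Lebesgue measurable functions enter at the end through Borel
  representatives.\<close>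

definition square_integrable :: "(real \<Rightarrow> complex) \<Rightarrow> bool" where
  "square_integrable f \<longleftrightarrow> f \<in> borel_measurable borel \<and> integrable lborel (\<lambda>t. (cmod (f t))\<^sup>2)"

definition norm_sq :: "(real \<Rightarrow> complex) \<Rightarrow> real" where
  "norm_sq f = (LINT t|lborel. (cmod (f t))\<^sup>2)"

lemma norm_sq_nonneg [simp]: "0 \<le> norm_sq f"
  by (simp add: norm_sq_def)

lemma borel_measurable_tf_shift_gauss_window [measurable]:
  assumes [measurable]: "f \<in> borel_measurable M" "g \<in> borel_measurable M"
  shows "(\<lambda>x. tf_shift (f x) gauss_window (g x)) \<in> borel_measurable M"
  unfolding tf_shift_def gauss_window_def by measurable

lemma tf_shift_eq_cis: "tf_shift z f t = cis (2 * pi * Im z * t) * f (t - Re z)"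
  by (simp add: tf_shift_def cis_conv_exp mult_ac)

lemma cmod_tf_shift_gauss_window:
  "cmod (tf_shift z gauss_window t) = 2 powr (1/4) * exp (- pi * (t - Re z)\<^sup>2)"
  by (simp add: tf_shift_eq_cis gauss_window_def norm_mult)

lemma tf_shift_gauss_window_square:
  "has_bochner_integral lborel (\<lambda>t. (cmod (tf_shift z gauss_window t))\<^sup>2) 1"
proof -
  have "((2::real) powr (1/4))\<^sup>2 = sqrt 2"
    by (simp add: power2_eq_square powr_half_sqrt flip: powr_add)
  then have "(cmod (tf_shift z gauss_window t))\<^sup>2 = normal_density (Re z) (1 / (2 * sqrt pi)) t" for t
    unfolding cmod_tf_shift_gauss_window
    by (simp add: normal_density_def power_mult_distrib power_divide real_sqrt_divide field_simps flip: exp_double)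
  then show ?thesis
    by (simp add: has_bochner_integral_iff)
qed

lemma cmod_tf_shift_gauss_window_le: "cmod (tf_shift z gauss_window t) \<le> 2 powr (1/4)"
  unfolding cmod_tf_shift_gauss_window by simp

lemma integral_mult_tf_shift_le:
  assumes "square_integrable f"
  shows "integrable lborel (\<lambda>t. f t * cnj (tf_shift z gauss_window t))"
    and "(LINT t|lborel. cmod (f t) * cmod (tf_shift z gauss_window t)) \<le> norm_sq f + 1"
proof -
  have [measurable]: "f \<in> borel_measurable borel" and f2: "integrable lborel (\<lambda>t. (cmod (f t))\<^sup>2)"
    using assms by (auto simp: square_integrable_def)
  note p = tf_shift_gauss_window_square[of z, unfolded has_bochner_integral_iff]
  show "integrable lborel (\<lambda>t. f t * cnj (tf_shift z gauss_window t))"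
    using f2 p by (intro integrable_mult_square_integrable) auto
  have "(LINT t|lborel. cmod (f t) * cmod (tf_shift z gauss_window t))
      \<le> (LINT t|lborel. (cmod (f t))\<^sup>2 + (cmod (tf_shift z gauss_window t))\<^sup>2)"
  proof (rule integral_mono)
    show "integrable lborel (\<lambda>t. cmod (f t) * cmod (tf_shift z gauss_window t))"
      using f2 p by (intro integrable_mult_square_integrable) auto
    show "cmod (f t) * cmod (tf_shift z gauss_window t) \<le> (cmod (f t))\<^sup>2 + (cmod (tf_shift z gauss_window t))\<^sup>2" for t
      using sum_squares_bound[of "cmod (f t)" "cmod (tf_shift z gauss_window t)"]
        mult_nonneg_nonneg[OF norm_ge_zero norm_ge_zero, of "f t" "tf_shift z gauss_window t"] by linarith
  qed (use f2 p in auto)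
  also have "\<dots> = norm_sq f + 1"
    using f2 p by (simp add: norm_sq_def)
  finally show "(LINT t|lborel. cmod (f t) * cmod (tf_shift z gauss_window t)) \<le> norm_sq f + 1" .
qed

text \<open>A crude bound, the summand 1 being the squared norm of the window. It serves only to
  dominate integrals uniformly in \<open>z\<close>; the sharp constant comes from the
  eigenvalues.\<close>

lemma cmod_gabor_le:
  assumes "square_integrable f"
  shows "cmod (gabor f z) \<le> norm_sq f + 1"
  unfolding gabor_def
  by (rule order_trans[OF integral_norm_bound])
    (use integral_mult_tf_shift_le(2)[OF assms, of z] in \<open>simp add: norm_mult\<close>)

lemma borel_measurable_gabor [measurable]:
  assumes "square_integrable f"
  shows "gabor f \<in> borel_measurable borel"
proof -
  have [measurable]: "f \<in> borel_measurable borel"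
    using assms by (auto simp: square_integrable_def)
  show ?thesis
    unfolding gabor_def by measurable
qed

text \<open>The conjugated window is a phase times a Gaussian in |z| times the kernel at
  \<open>cnj z\<close>, by comparing exponents. Two such Gaussians multiply to exp(- pi |z|^2), the
  weight of the Bargmann-Fock space.\<close>

lemma gabor_eq_bargmann:
  "gabor f z = cis (- pi * Re z * Im z) * of_real (exp (- pi / 2 * (cmod z)\<^sup>2))
     * (LINT t|lborel. f t * bargmann_kernel (cnj z) t)"
proof -
  have "cnj (tf_shift z gauss_window t)
      = cis (- pi * Re z * Im z) * of_real (exp (- pi / 2 * (cmod z)\<^sup>2)) * bargmann_kernel (cnj z) t" for t
  proof -
    have "- (2 * of_real pi * \<i> * of_real (Im z) * of_real t) + of_real (- pi * (t - Re z)\<^sup>2)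
      = \<i> * of_real (- pi * Re z * Im z) + of_real (- pi / 2 * (cmod z)\<^sup>2)
        + (of_real (2 * pi * t) * cnj z - of_real (pi * t\<^sup>2) - of_real (pi / 2) * (cnj z)\<^sup>2)"
      unfolding cmod_power2
      by (simp add: complex_eq_iff power2_eq_square field_simps)
    from arg_cong[OF this, of exp] show ?thesis
      unfolding exp_add
      by (simp add: tf_shift_def gauss_window_def bargmann_kernel_def cis_conv_exp exp_cnj
          flip: exp_of_real)
  qed
  then show ?thesis
    by (simp add: gabor_def mult.left_commute[of "f _"] mult.assoc)
qed

lemma gabor_pairing_radial_compact_support:
  fixes F :: "complex \<Rightarrow> real"
  assumes [measurable]: "F \<in> borel_measurable borel" and F: "integrable lborel F"
    and supp: "\<And>z. R < cmod z \<Longrightarrow> F z = 0"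
    and radial: "AE z in lborel. F z = w (cmod z)"
    and dens: "bounded_density (\<lambda>z. \<bar>F z\<bar>) L M"
    and f: "square_integrable f" and g: "square_integrable g"
  shows "cmod (LINT z|lborel. of_real (F z) * (gabor f z * cnj (gabor g z)))
    \<le> M * (1 - exp (- (L / M))) * (sqrt (norm_sq f) * sqrt (norm_sq g))"
proof -
  define C where "C = M * (1 - exp (- (L / M)))"
  have C: "0 \<le> C" using bounded_density.L[OF dens] bounded_density.M[OF dens] by (simp add: C_def)
  define c where "c k = (LINT t|lborel. f t * of_real (hermite_fun k t))" for k
  define d where "d k = (LINT t|lborel. g t * of_real (hermite_fun k t))" for k
  define P where "P z = (LINT t|lborel. f t * bargmann_kernel z t)" for z
  define Q where "Q z = (LINT t|lborel. g t * bargmann_kernel z t)" for z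
  define W where "W z = F z * exp (- pi * (cmod z)\<^sup>2)" for z
  define \<mu> where "\<mu> k = (LINT z|lborel. W z * (cmod z) ^ (2 * k))" for k
  have [measurable]: "W \<in> borel_measurable borel" unfolding W_def by measurable
  have fm: "f \<in> borel_measurable borel" "integrable lborel (\<lambda>t. (cmod (f t))\<^sup>2)"
    and gm: "g \<in> borel_measurable borel" "integrable lborel (\<lambda>t. (cmod (g t))\<^sup>2)"
    using f g by (auto simp: square_integrable_def)
  have W: "integrable lborel W"
    by (rule Bochner_Integration.integrable_bound[OF F]) (auto simp: W_def abs_mult mult_left_le)
  have s1: "(\<lambda>k. c k * z ^ k) sums P z" and s2: "(\<lambda>k. d k * z ^ k) sums Q z" for z
    using bargmann_kernel_expansion[OF fm] bargmann_kernel_expansion[OF gm]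
    by (simp_all add: c_def d_def P_def Q_def)
  \<comment> \<open>The Gabor transform involves powers of \<open>cnj z\<close>; conjugating the
    whole integrand produces power series in \<open>z\<close>. The phases of the two transforms
    cancel and their Gaussian factors are absorbed into \<open>W\<close>.\<close>
  have eq: "of_real (W z) * (cnj (P (cnj z)) * cnj (cnj (Q (cnj z))))
      = cnj (of_real (F z) * (gabor f z * cnj (gabor g z)))" for z
  proof -
    define u where "u = cis (- pi * Re z * Im z)"
    define e where "e = exp (- pi / 2 * (cmod z)\<^sup>2)"
    have "e * e = exp (- pi * (cmod z)\<^sup>2)"
      by (simp add: e_def flip: exp_add)
    then have W_eq: "complex_of_real (W z) = of_real (F z) * (of_real e * of_real e)"
      by (simp add: W_def flip: of_real_mult)
    have "cnj u * u = 1"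
      by (simp add: u_def cis_cnj cis_mult)
    then have "of_real (W z) * (cnj (P (cnj z)) * Q (cnj z))
        = of_real (F z) * (cnj u * u) * (of_real e * of_real e) * (cnj (P (cnj z)) * Q (cnj z))"
      by (simp add: W_eq)
    also have "\<dots> = cnj (of_real (F z) * (u * of_real e * P (cnj z) * cnj (u * of_real e * Q (cnj z))))"
      by (simp add: mult_ac)
    finally show ?thesis
      unfolding gabor_eq_bargmann P_def[symmetric] Q_def[symmetric] u_def e_def by simp
  qed
  have "(\<lambda>k. cnj (c k) * cnj (cnj (d k)) * of_real (\<mu> k)) sums
      (LINT z|lborel. of_real (W z) * (cnj (P (cnj z)) * cnj (cnj (Q (cnj z)))))"
    unfolding \<mu>_def
  proof (rule radial_power_series_pairing[where w = "\<lambda>r. w r * exp (- pi * r\<^sup>2)"])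
    show "AE z in lborel. W z = w (cmod z) * exp (- pi * (cmod z)\<^sup>2)"
      using radial by eventually_elim (simp add: W_def)
    have "(\<lambda>k. cnj (c k * cnj z ^ k)) sums cnj (P (cnj z))" for z
      using s1[of "cnj z"] by (simp only: sums_cnj)
    then show "(\<lambda>k. cnj (c k) * z ^ k) sums cnj (P (cnj z))" for z by simp
    have "(\<lambda>k. cnj (d k * cnj z ^ k)) sums cnj (Q (cnj z))" for z
      using s2[of "cnj z"] by (simp only: sums_cnj)
    then show "(\<lambda>k. cnj (d k) * z ^ k) sums cnj (Q (cnj z))" for z by simp
    show "W z = 0" if "R < cmod z" for z
      using supp[OF that] by (simp add: W_def)
  qed (use W in auto)
  then have "(\<lambda>k. cnj (c k) * d k * of_real (\<mu> k)) sums
      cnj (LINT z|lborel. of_real (F z) * (gabor f z * cnj (gabor g z)))"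
    unfolding eq integral_cnj by (simp del: complex_cnj_mult)
  then have lim: "(\<lambda>N. cmod (\<Sum>k<N. cnj (c k) * d k * of_real (\<mu> k)))
      \<longlonglongrightarrow> cmod (LINT z|lborel. of_real (F z) * (gabor f z * cnj (gabor g z)))"
    unfolding sums_def by (subst complex_mod_cnj[symmetric]) (rule tendsto_norm)
  \<comment> \<open>The squared norm of \<open>hermite_fun k\<close> is pi^k / k!, so the eigenvalue
    of index k is (pi^k / k!) \<open>\<mu> k\<close>, the Gamma moment of the symbol. The claim says
    that it is at most \<open>C\<close> in absolute value.\<close>
  have \<mu>: "\<bar>\<mu> k\<bar> \<le> C / (pi ^ k / fact k)" for k
  proof -
    let ?X = "\<lambda>z. W z * (cmod z) ^ (2 * k)"
    have "\<bar>\<mu> k\<bar> \<le> (LINT z|lborel. \<bar>?X z\<bar>)"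
      unfolding \<mu>_def using integral_norm_bound[of lborel ?X] by simp
    also have "\<dots> = enn2real (\<integral>\<^sup>+z. ennreal \<bar>?X z\<bar> \<partial>lborel)"
      by (rule integral_eq_nn_integral) auto
    also have "(\<integral>\<^sup>+z. ennreal \<bar>?X z\<bar> \<partial>lborel)
      = (\<integral>\<^sup>+z. ennreal (fact k / pi ^ k) * ennreal (\<bar>F z\<bar> * (exp (- (pi * (cmod z)\<^sup>2)) * (pi * (cmod z)\<^sup>2) ^ k / fact k)) \<partial>lborel)"
      by (intro nn_integral_cong)
        (simp add: W_def abs_mult power_mult power_mult_distrib flip: ennreal_mult)
    also have "\<dots> = ennreal (fact k / pi ^ k) * (\<integral>\<^sup>+z. ennreal (\<bar>F z\<bar> * (exp (- (pi * (cmod z)\<^sup>2)) * (pi * (cmod z)\<^sup>2) ^ k / fact k)) \<partial>lborel)"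
      by (rule nn_integral_cmult) measurable
    also have "enn2real \<dots> \<le> enn2real (ennreal (fact k / pi ^ k) * ennreal C)"
      by (intro enn2real_mono mult_left_mono bounded_density.gamma_moment_le[OF dens, folded C_def])
        (auto simp: ennreal_mult_less_top)
    also have "\<dots> = C / (pi ^ k / fact k)"
      using C by (simp add: ennreal_mult[symmetric] mult.commute)
    finally show ?thesis .
  qed
  have "cmod (\<Sum>k<N. cnj (c k) * d k * of_real (\<mu> k)) \<le> C * (sqrt (norm_sq f) * sqrt (norm_sq g))" for N
  proof -
    define \<nu> where "\<nu> k = pi ^ k / fact k" for k
    have \<nu>: "0 < \<nu> k" for k by (simp add: \<nu>_def)
    have "cmod (\<Sum>k<N. cnj (c k) * d k * of_real (\<mu> k)) \<le> (\<Sum>k<N. cmod (c k) * cmod (d k) * \<bar>\<mu> k\<bar>)"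
      by (rule order_trans[OF norm_sum]) (simp add: norm_mult)
    also have "\<dots> \<le> (\<Sum>k<N. cmod (c k) * cmod (d k) * (C / \<nu> k))"
      using \<mu> by (intro sum_mono mult_left_mono) (auto simp: \<nu>_def)
    \<comment> \<open>Splitting \<open>\<nu> k\<close> into two square roots normalises both
      coefficient sequences, to which Cauchy-Schwarz and then Bessel apply.\<close>
    also have "\<dots> = C * (\<Sum>k<N. \<bar>cmod (c k) / sqrt (\<nu> k)\<bar> * \<bar>cmod (d k) / sqrt (\<nu> k)\<bar>)"
      unfolding sum_distrib_left using \<nu> by (intro sum.cong) (simp_all add: less_imp_le)
    also have "\<dots> \<le> C * (L2_set (\<lambda>k. cmod (c k) / sqrt (\<nu> k)) {..<N} * L2_set (\<lambda>k. cmod (d k) / sqrt (\<nu> k)) {..<N})"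
      using C by (intro mult_left_mono L2_set_mult_ineq)
    also have "\<dots> \<le> C * (sqrt (norm_sq f) * sqrt (norm_sq g))"
    proof (intro mult_left_mono mult_mono)
      show "L2_set (\<lambda>k. cmod (c k) / sqrt (\<nu> k)) {..<N} \<le> sqrt (norm_sq f)"
        using hermite_coeff_Bessel[OF fm, of N] \<nu>
        by (simp add: L2_set_def power_divide less_imp_le norm_sq_def c_def \<nu>_def[symmetric])
      show "L2_set (\<lambda>k. cmod (d k) / sqrt (\<nu> k)) {..<N} \<le> sqrt (norm_sq g)"
        using hermite_coeff_Bessel[OF gm, of N] \<nu>
        by (simp add: L2_set_def power_divide less_imp_le norm_sq_def d_def \<nu>_def[symmetric])
    qed (use C in \<open>auto simp: L2_set_nonneg\<close>)
    finally show ?thesis .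
  qed
  then show ?thesis
    unfolding C_def[symmetric] by (intro LIMSEQ_le_const2[OF lim]) auto
qed

section \<open>Integrable radial symbols and arbitrary centres\<close>

lemma cmod_gabor_pairing_le:
  assumes f: "square_integrable f" and g: "square_integrable g"
  shows "cmod (of_real x * (gabor f z * cnj (gabor g z))) \<le> \<bar>x\<bar> * ((norm_sq f + 1) * (norm_sq g + 1))"
  unfolding norm_mult using cmod_gabor_le[OF f, of z] cmod_gabor_le[OF g, of z]
  by (auto intro!: mult_mono mult_left_mono)

text \<open>Cutting the symbol off outside discs about 0 keeps it radial and keeps \<open>L\<close>
  and \<open>M\<close>, so the bound is uniform in the radius and passes to the limit by dominated
  convergence.\<close>

lemma gabor_pairing_radial:
  fixes F :: "complex \<Rightarrow> real"
  assumes F: "integrable lborel F"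
    and radial: "AE z in lborel. F z = w (cmod z)"
    and dens: "bounded_density (\<lambda>z. \<bar>F z\<bar>) L M"
    and f: "square_integrable f" and g: "square_integrable g"
  shows "cmod (LINT z|lborel. of_real (F z) * (gabor f z * cnj (gabor g z)))
    \<le> M * (1 - exp (- (L / M))) * (sqrt (norm_sq f) * sqrt (norm_sq g))"
proof -
  interpret bounded_density "\<lambda>z. \<bar>F z\<bar>" L M by (rule dens)
  have [measurable]: "F \<in> borel_measurable borel" using F by auto
  note [measurable] = borel_measurable_gabor[OF f] borel_measurable_gabor[OF g]
  define Fn where "Fn n z = F z * indicator (cball 0 (real n)) z" for n z
  have Fn_le: "\<bar>Fn n z\<bar> \<le> \<bar>F z\<bar>" for n z
    by (auto simp: Fn_def indicator_def)
  have [measurable]: "Fn n \<in> borel_measurable borel" for n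
    unfolding Fn_def by (intro borel_measurable_times borel_measurable_indicator) auto
  have Fn: "integrable lborel (Fn n)" for n
    by (rule Bochner_Integration.integrable_bound[OF F]) (use Fn_le in auto)
  have supp: "Fn n z = 0" if "real n < cmod z" for n z
    using that by (simp add: Fn_def)
  have "bounded_density (\<lambda>z. \<bar>Fn n z\<bar>) L M" for n
  proof
    show "AE z in lborel. \<bar>Fn n z\<bar> \<le> M"
      using AE_le by eventually_elim (use Fn_le in \<open>blast intro: order_trans\<close>)
    show "(\<integral>\<^sup>+z. ennreal \<bar>Fn n z\<bar> \<partial>lborel) \<le> ennreal L"
      by (rule order_trans[OF nn_integral_mono mass]) (use Fn_le in \<open>simp add: ennreal_leI\<close>)
  qed (use L M in auto)
  moreover have "AE z in lborel. Fn n z = w (cmod z) * indicator {..real n} (cmod z)" for n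
    using radial by eventually_elim (auto simp: Fn_def indicator_def)
  ultimately have bd: "cmod (LINT z|lborel. of_real (Fn n z) * (gabor f z * cnj (gabor g z)))
      \<le> M * (1 - exp (- (L / M))) * (sqrt (norm_sq f) * sqrt (norm_sq g))" for n
    using f g Fn supp
    by (intro gabor_pairing_radial_compact_support[where R = "real n"
          and w = "\<lambda>r. w r * indicator {..real n} r"]) auto
  have "(\<lambda>n. LINT z|lborel. of_real (Fn n z) * (gabor f z * cnj (gabor g z)))
      \<longlonglongrightarrow> (LINT z|lborel. of_real (F z) * (gabor f z * cnj (gabor g z)))"
  proof (rule integral_dominated_convergence[where w = "\<lambda>z. \<bar>F z\<bar> * ((norm_sq f + 1) * (norm_sq g + 1))"])
    show "integrable lborel (\<lambda>z. \<bar>F z\<bar> * ((norm_sq f + 1) * (norm_sq g + 1)))" using F by simp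
    show "AE z in lborel. (\<lambda>n. of_real (Fn n z) * (gabor f z * cnj (gabor g z)))
        \<longlonglongrightarrow> of_real (F z) * (gabor f z * cnj (gabor g z))"
    proof (intro AE_I2 tendsto_eventually)
      fix z
      have "\<forall>\<^sub>F n in sequentially. cmod z \<le> real n"
        using eventually_ge_at_top[of "nat \<lceil>cmod z\<rceil>"] by eventually_elim linarith
      then show "\<forall>\<^sub>F n in sequentially. of_real (Fn n z) * (gabor f z * cnj (gabor g z))
          = of_real (F z) * (gabor f z * cnj (gabor g z))"
        by eventually_elim (simp add: Fn_def)
    qed
    show "AE z in lborel. norm (of_real (Fn n z) * (gabor f z * cnj (gabor g z)))
        \<le> \<bar>F z\<bar> * ((norm_sq f + 1) * (norm_sq g + 1))" for n
      using Fn_le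
      by (intro AE_I2) (auto intro!: order_trans[OF cmod_gabor_pairing_le[OF f g]] mult_right_mono)
  qed measurable
  from tendsto_norm[OF this] show ?thesis
    by (rule LIMSEQ_le_const2) (use bd in auto)
qed

text \<open>Covariance under time-frequency shifts, by substituting t + Re a for t;
  \<open>fa\<close> is \<open>f\<close> shifted back by \<open>a\<close>, up to a constant phase.
  The remaining factor depends on \<open>a\<close> and \<open>z\<close> but not on \<open>f\<close>,
  so it disappears when two transforms are paired.\<close>

lemma gabor_translate:
  fixes a z :: complex and f :: "real \<Rightarrow> complex"
  defines "fa \<equiv> \<lambda>t. f (t + Re a) * cis (- 2 * pi * Im a * t)"
  shows "gabor f (a + z) = cis (- 2 * pi * Im (a + z) * Re a) * gabor fa z"
proof -
  have "f (Re a + t) * cnj (tf_shift (a + z) gauss_window (Re a + t))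
      = cis (- 2 * pi * Im (a + z) * Re a) * (fa t * cnj (tf_shift z gauss_window t))" for t
  proof -
    have "cnj (tf_shift (a + z) gauss_window (Re a + t))
      = cis (- 2 * pi * Im (a + z) * Re a) * cis (- 2 * pi * Im a * t) * cnj (tf_shift z gauss_window t)"
      by (simp add: tf_shift_eq_cis cis_cnj gauss_window_def cis_mult algebra_simps)
    then show ?thesis
      by (simp add: fa_def add.commute mult_ac)
  qed
  then have "(LINT t|lborel. f (Re a + 1 * t) * cnj (tf_shift (a + z) gauss_window (Re a + 1 * t)))
      = cis (- 2 * pi * Im (a + z) * Re a) * gabor fa z"
    by (simp add: gabor_def)
  then show ?thesis
    unfolding gabor_def by (subst lborel_integral_real_affine[of 1 _ "Re a"]) simp_all
qed

lemma gabor_pairing_radial_wrt: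
  fixes F :: "complex \<Rightarrow> real"
  assumes F: "integrable lborel F"
    and radial: "AE z in lborel. F z = w (cmod (z - a))"
    and dens: "bounded_density (\<lambda>z. \<bar>F z\<bar>) L M"
    and f: "square_integrable f" and g: "square_integrable g"
  shows "cmod (LINT z|lborel. of_real (F z) * (gabor f z * cnj (gabor g z)))
    \<le> M * (1 - exp (- (L / M))) * (sqrt (norm_sq f) * sqrt (norm_sq g))"
proof -
  interpret bounded_density "\<lambda>z. \<bar>F z\<bar>" L M by (rule dens)
  have [measurable]: "F \<in> borel_measurable borel" using F by auto
  note [measurable] = borel_measurable_gabor[OF f] borel_measurable_gabor[OF g]
  have shift: "distr lborel borel ((+) a) = (lborel :: complex measure)"
    by (rule lborel_distr_plus)
  define sh where "sh h = (\<lambda>t. h (t + Re a) * cis (- 2 * pi * Im a * t))" for h :: "real \<Rightarrow> complex"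
  have sh: "square_integrable (sh h)" "norm_sq (sh h) = norm_sq h" if "square_integrable h" for h
  proof -
    have [measurable]: "h \<in> borel_measurable borel" and h: "integrable lborel (\<lambda>t. (cmod (h t))\<^sup>2)"
      using that by (auto simp: square_integrable_def)
    have "cis \<in> borel_measurable borel"
      by (intro borel_measurable_continuous_onI continuous_intros)
    note [measurable] = measurable_compose[OF _ this]
    have "sh h \<in> borel_measurable borel" unfolding sh_def by measurable
    moreover have "(cmod (sh h t))\<^sup>2 = (cmod (h (Re a + 1 * t)))\<^sup>2" for t
      by (simp add: sh_def norm_mult add.commute)
    ultimately show "square_integrable (sh h)"
      using lborel_integrable_real_affine[OF h, of 1 "Re a"] by (simp add: square_integrable_def)
    show "norm_sq (sh h) = norm_sq h"
      unfolding norm_sq_def \<open>\<And>t. (cmod (sh h t))\<^sup>2 = (cmod (h (Re a + 1 * t)))\<^sup>2\<close>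
      by (subst (2) lborel_integral_real_affine[of 1 _ "Re a"]) simp_all
  qed
  have "integrable (distr lborel borel ((+) a)) F"
    using F by (simp add: shift)
  then have F': "integrable lborel (\<lambda>z. F (a + z))"
    by (subst (asm) integrable_distr_eq) auto
  have AE_shift: "AE z in lborel. P (a + z)" if "AE z in lborel. P z" for P :: "complex \<Rightarrow> bool"
    by (rule AE_distrD[of "(+) a" lborel borel P]) (simp, subst shift, rule that)
  have dens': "bounded_density (\<lambda>z. \<bar>F (a + z)\<bar>) L M"
  proof
    show "AE z in lborel. \<bar>F (a + z)\<bar> \<le> M"
      using AE_shift[OF AE_le] .
    have "(\<integral>\<^sup>+z. ennreal \<bar>F (a + z)\<bar> \<partial>lborel) = (\<integral>\<^sup>+z. ennreal \<bar>F z\<bar> \<partial>distr lborel borel ((+) a))"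
      by (subst nn_integral_distr) auto
    then show "(\<integral>\<^sup>+z. ennreal \<bar>F (a + z)\<bar> \<partial>lborel) \<le> ennreal L"
      using mass by (simp add: shift)
  qed (use L M in auto)
  have "(LINT z|lborel. of_real (F z) * (gabor f z * cnj (gabor g z)))
      = (LINT z|distr lborel borel ((+) a). of_real (F z) * (gabor f z * cnj (gabor g z)))"
    by (simp add: shift)
  also have "\<dots> = (LINT z|lborel. of_real (F (a + z)) * (gabor f (a + z) * cnj (gabor g (a + z))))"
    by (subst integral_distr) auto
  also have "\<dots> = (LINT z|lborel. of_real (F (a + z)) * (gabor (sh f) z * cnj (gabor (sh g) z)))"
  proof (intro Bochner_Integration.integral_cong refl)
    fix z
    define u where "u = cis (- 2 * pi * Im (a + z) * Re a)"
    have "u * cnj u = 1" by (simp add: u_def cis_cnj cis_mult)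
    then have "(u * x) * cnj (u * y) = x * cnj y" for x y
      by (simp add: mult_ac)
    then show "of_real (F (a + z)) * (gabor f (a + z) * cnj (gabor g (a + z)))
      = of_real (F (a + z)) * (gabor (sh f) z * cnj (gabor (sh g) z))"
      unfolding gabor_translate sh_def[symmetric] u_def[symmetric] by simp
  qed
  also have "cmod \<dots> \<le> M * (1 - exp (- (L / M))) * (sqrt (norm_sq (sh f)) * sqrt (norm_sq (sh g)))"
  proof (rule gabor_pairing_radial[OF F' _ dens'])
    show "AE z in lborel. F (a + z) = w (cmod z)"
      using AE_shift[OF radial] by simp
  qed (use sh f g in auto)
  finally show ?thesis
    by (simp add: sh f g)
qed

section \<open>From the sesquilinear form to the operator\<close>

definition loc_op :: "(complex \<Rightarrow> real) \<Rightarrow> (real \<Rightarrow> complex) \<Rightarrow> real \<Rightarrow> complex" where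
  "loc_op F f t = (LINT z|lborel. of_real (F z) * gabor f z * tf_shift z gauss_window t)"

lemma borel_measurable_loc_op:
  assumes [measurable]: "F \<in> borel_measurable borel" and f: "square_integrable f"
  shows "loc_op F f \<in> borel_measurable borel"
proof -
  note [measurable] = borel_measurable_gabor[OF f]
  show ?thesis unfolding loc_op_def by measurable
qed

text \<open>A bound uniform in \<open>t\<close>, which makes the restriction of the image to a
  bounded interval square integrable before the image itself is known to be so.\<close>

lemma cmod_loc_op_le:
  assumes F: "integrable lborel F" and f: "square_integrable f"
  shows "cmod (loc_op F f t) \<le> (LINT z|lborel. \<bar>F z\<bar>) * ((norm_sq f + 1) * 2 powr (1/4))"
proof -
  have [measurable]: "F \<in> borel_measurable borel" using F by auto
  note [measurable] = borel_measurable_gabor[OF f]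
  have le: "cmod (of_real (F z) * gabor f z * tf_shift z gauss_window t) \<le> \<bar>F z\<bar> * ((norm_sq f + 1) * 2 powr (1/4))" for z
    unfolding norm_mult mult.assoc using cmod_gabor_le[OF f, of z] cmod_tf_shift_gauss_window_le[of z t]
    by (auto intro!: mult_mono mult_left_mono)
  have "cmod (loc_op F f t) \<le> (LINT z|lborel. cmod (of_real (F z) * gabor f z * tf_shift z gauss_window t))"
    unfolding loc_op_def by (rule integral_norm_bound)
  also have "\<dots> \<le> (LINT z|lborel. \<bar>F z\<bar> * ((norm_sq f + 1) * 2 powr (1/4)))"
  proof (rule integral_mono)
    show int: "integrable lborel (\<lambda>z. \<bar>F z\<bar> * ((norm_sq f + 1) * 2 powr (1/4)))" using F by simp
    show "integrable lborel (\<lambda>z. cmod (of_real (F z) * gabor f z * tf_shift z gauss_window t))"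
      by (rule Bochner_Integration.integrable_bound[OF int]) (use le in \<open>auto intro: order_trans\<close>)
  qed (rule le)
  finally show ?thesis by simp
qed

text \<open>Fubini: integrating over t first turns the window and \<open>g\<close> into the
  conjugate of the Gabor transform of \<open>g\<close>. Absolute integrability follows from that of
  \<open>F\<close> and the uniform bounds on the two inner factors.\<close>

lemma loc_op_pairing:
  assumes F: "integrable lborel F" and f: "square_integrable f" and g: "square_integrable g"
  shows "(LINT t|lborel. loc_op F f t * cnj (g t)) = (LINT z|lborel. of_real (F z) * (gabor f z * cnj (gabor g z)))"
proof -
  have [measurable]: "F \<in> borel_measurable borel" using F by auto
  note [measurable] = borel_measurable_gabor[OF f] 
  have [measurable]: "g \<in> borel_measurable borel" using g by (auto simp: square_integrable_def)
  let ?h = "\<lambda>z t. of_real (F z) * gabor f z * (tf_shift z gauss_window t * cnj (g t))"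
  have cg: "(LINT t|lborel. tf_shift z gauss_window t * cnj (g t)) = cnj (gabor g z)" for z
  proof -
    have "cnj (gabor g z) = (LINT t|lborel. cnj (g t * cnj (tf_shift z gauss_window t)))"
      unfolding gabor_def by (simp del: complex_cnj_mult)
    then show ?thesis by (simp only: complex_cnj_mult complex_cnj_cnj mult.commute)
  qed
  have ig: "integrable lborel (\<lambda>t. tf_shift z gauss_window t * cnj (g t))" for z
    using integrable_cnj[OF integral_mult_tf_shift_le(1)[OF g, of z]] by (simp add: mult.commute)
  have int: "integrable (lborel \<Otimes>\<^sub>M lborel) (\<lambda>(z, t). ?h z t)"
  proof (rule lborel_pair.Fubini_integrable)
    show "(\<lambda>(z, t). ?h z t) \<in> borel_measurable (lborel \<Otimes>\<^sub>M lborel)" by measurable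
    have B: "(LINT t|lborel. norm (?h z t)) \<le> \<bar>F z\<bar> * ((norm_sq f + 1) * (norm_sq g + 1))" for z
    proof -
      have "(LINT t|lborel. norm (?h z t))
          = \<bar>F z\<bar> * (cmod (gabor f z) * (LINT t|lborel. cmod (g t) * cmod (tf_shift z gauss_window t)))"
        by (simp add: norm_mult mult.commute[of "cmod (g _)"] mult.assoc)
      also have "\<dots> \<le> \<bar>F z\<bar> * ((norm_sq f + 1) * (norm_sq g + 1))"
        using cmod_gabor_le[OF f, of z] integral_mult_tf_shift_le(2)[OF g, of z]
        by (intro mult_left_mono mult_mono) auto
      finally show ?thesis .
    qed
    show "integrable lborel (\<lambda>z. LINT t|lborel. norm (case (z, t) of (z, t) \<Rightarrow> ?h z t))"
    proof (rule Bochner_Integration.integrable_bound)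
      show "integrable lborel (\<lambda>z. \<bar>F z\<bar> * ((norm_sq f + 1) * (norm_sq g + 1)))" using F by simp
      show "AE z in lborel. norm (LINT t|lborel. norm (case (z, t) of (z, t) \<Rightarrow> ?h z t))
          \<le> norm (\<bar>F z\<bar> * ((norm_sq f + 1) * (norm_sq g + 1)))"
        using B by (intro AE_I2) (auto intro: order_trans)
    qed measurable
    show "AE z in lborel. integrable lborel (\<lambda>t. case (z, t) of (z, t) \<Rightarrow> ?h z t)"
      using ig by simp
  qed
  have "(LINT t|lborel. loc_op F f t * cnj (g t)) = (LINT t|lborel. (LINT z|lborel. ?h z t))"
    unfolding loc_op_def by (simp add: mult.assoc flip: integral_mult_left_zero)
  also have "\<dots> = (LINT z|lborel. (LINT t|lborel. ?h z t))"
    by (rule lborel_pair.Fubini_integral[OF int])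
  also have "\<dots> = (LINT z|lborel. of_real (F z) * (gabor f z * cnj (gabor g z)))"
    by (simp add: cg mult.assoc)
  finally show ?thesis .
qed

text \<open>Testing against the truncations of the image itself turns the bound on the sesquilinear form
  into square integrability of the image.\<close>

lemma loc_op_norm_sq_le:
  fixes F :: "complex \<Rightarrow> real"
  assumes F: "integrable lborel F"
    and radial: "AE z in lborel. F z = w (cmod (z - a))"
    and dens: "bounded_density (\<lambda>z. \<bar>F z\<bar>) L M"
    and f: "square_integrable f"
  defines "C \<equiv> M * (1 - exp (- (L / M)))"
  shows "square_integrable (loc_op F f)" and "norm_sq (loc_op F f) \<le> C\<^sup>2 * norm_sq f"
proof -
  have C: "0 \<le> C" using bounded_density.L[OF dens] bounded_density.M[OF dens] by (simp add: C_def)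
  have [measurable]: "F \<in> borel_measurable borel" using F by auto
  note [measurable] = borel_measurable_loc_op[OF _ f, of F]
  define B where "B = (LINT z|lborel. \<bar>F z\<bar>) * ((norm_sq f + 1) * 2 powr (1/4))"
  define T where "T = loc_op F f"
  have [measurable]: "T \<in> borel_measurable borel" unfolding T_def by measurable
  have TB: "cmod (T t) \<le> B" for t unfolding T_def B_def by (rule cmod_loc_op_le[OF F f])
  define g where "g n t = T t * indicator {- real n..real n} t" for n t
  have g: "square_integrable (g n)" for n
    unfolding square_integrable_def
  proof
    show [measurable]: "g n \<in> borel_measurable borel" unfolding g_def by measurable
    show "integrable lborel (\<lambda>t. (cmod (g n t))\<^sup>2)"
    proof (rule Bochner_Integration.integrable_bound)
      show "integrable lborel (\<lambda>t. B\<^sup>2 * indicator {- real n..real n} t)" by simp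
      show "AE t in lborel. norm ((cmod (g n t))\<^sup>2) \<le> norm (B\<^sup>2 * indicator {- real n..real n} t)"
        using TB by (intro AE_I2) (auto simp: g_def indicator_def norm_mult intro: power_mono)
    qed measurable
  qed
  have le: "norm_sq (g n) \<le> C\<^sup>2 * norm_sq f" for n
  proof -
    \<comment> \<open>\<open>g n\<close> is \<open>T\<close> or 0, so testing \<open>T\<close>
      against it gives exactly the squared norm of \<open>g n\<close>.\<close>
    have "T t * cnj (g n t) = complex_of_real ((cmod (g n t))\<^sup>2)" for t
      using complex_norm_square[of "T t"] by (simp add: g_def indicator_def)
    then have "complex_of_real (norm_sq (g n)) = (LINT t|lborel. T t * cnj (g n t))"
      by (simp only: norm_sq_def integral_complex_of_real)
    then have "norm_sq (g n) = cmod (LINT t|lborel. T t * cnj (g n t))"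
      by (metis norm_sq_nonneg norm_of_real abs_of_nonneg)
    also have "\<dots> \<le> C * (sqrt (norm_sq f) * sqrt (norm_sq (g n)))"
      unfolding T_def loc_op_pairing[OF F f g] C_def by (rule gabor_pairing_radial_wrt[OF F radial dens f g])
    finally have *: "sqrt (norm_sq (g n)) * sqrt (norm_sq (g n)) \<le> (C * sqrt (norm_sq f)) * sqrt (norm_sq (g n))"
      by (simp add: mult_ac)
    \<comment> \<open>One factor, the norm of \<open>g n\<close>, is cancelled; it is finite because
      \<open>g n\<close> is truncated, and a vanishing norm is treated apart.\<close>
    have "sqrt (norm_sq (g n)) \<le> C * sqrt (norm_sq f)"
    proof (cases "norm_sq (g n) = 0")
      case False
      then have "0 < norm_sq (g n)" using norm_sq_nonneg[of "g n"] by linarith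
      then have "0 < sqrt (norm_sq (g n))" by simp
      then show ?thesis using * by (simp only: mult_le_cancel_right_pos)
    qed (use C in simp)
    from power_mono[OF this, of 2] show ?thesis by (simp add: power_mult_distrib)
  qed
  have "(\<lambda>n. \<integral>\<^sup>+t. ennreal ((cmod (g n t))\<^sup>2) \<partial>lborel) \<longlonglongrightarrow> (\<integral>\<^sup>+t. ennreal ((cmod (T t))\<^sup>2) \<partial>lborel)"
  proof (rule nn_integral_LIMSEQ)
    show "incseq (\<lambda>n t. ennreal ((cmod (g n t))\<^sup>2))"
      by (auto simp: incseq_def le_fun_def g_def indicator_def)
    show "(\<lambda>t. ennreal ((cmod (g n t))\<^sup>2)) \<in> borel_measurable lborel" for n
      unfolding g_def by measurable
    show "(\<lambda>n. ennreal ((cmod (g n t))\<^sup>2)) \<longlonglongrightarrow> ennreal ((cmod (T t))\<^sup>2)" for t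
    proof (rule tendsto_eventually)
      have "\<forall>\<^sub>F n in sequentially. \<bar>t\<bar> \<le> real n"
        using eventually_ge_at_top[of "nat \<lceil>\<bar>t\<bar>\<rceil>"] by eventually_elim linarith
      then show "\<forall>\<^sub>F n in sequentially. ennreal ((cmod (g n t))\<^sup>2) = ennreal ((cmod (T t))\<^sup>2)"
        by eventually_elim (auto simp: g_def indicator_def)
    qed
  qed
  moreover have "(\<integral>\<^sup>+t. ennreal ((cmod (g n t))\<^sup>2) \<partial>lborel) \<le> ennreal (C\<^sup>2 * norm_sq f)" for n
    using le[of n] g[of n]
    by (subst nn_integral_eq_integral) (auto simp: square_integrable_def norm_sq_def intro: ennreal_leI)
  ultimately have bd: "(\<integral>\<^sup>+t. ennreal ((cmod (T t))\<^sup>2) \<partial>lborel) \<le> ennreal (C\<^sup>2 * norm_sq f)"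
    by (intro LIMSEQ_le_const2) auto
  then have "integrable lborel (\<lambda>t. (cmod (T t))\<^sup>2)"
    by (intro integrableI_nonneg) (auto simp: le_less_trans)
  then show "square_integrable (loc_op F f)"
    by (simp add: square_integrable_def T_def[symmetric])
  have "norm_sq T = enn2real (\<integral>\<^sup>+t. ennreal ((cmod (T t))\<^sup>2) \<partial>lborel)"
    unfolding norm_sq_def by (rule integral_eq_nn_integral) auto
  also have "\<dots> \<le> enn2real (ennreal (C\<^sup>2 * norm_sq f))"
    by (rule enn2real_mono[OF bd]) simp
  finally show "norm_sq (loc_op F f) \<le> C\<^sup>2 * norm_sq f"
    by (simp add: T_def)
qed

section \<open>The localization operator on Lebesgue space\<close>

lemma completion_ex_borel_measurable_complex:
  fixes g :: "'a \<Rightarrow> complex"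
  assumes "g \<in> borel_measurable (completion M)"
  shows "\<exists>g'\<in>borel_measurable M. AE x in M. g x = g' x"
proof -
  have "(\<lambda>x. Re (g x)) \<in> borel_measurable (completion M)" "(\<lambda>x. Im (g x)) \<in> borel_measurable (completion M)"
    using assms by auto
  from this[THEN completion_ex_borel_measurable_real]
  obtain u v where uv: "u \<in> borel_measurable M" "AE x in M. Re (g x) = u x"
    "v \<in> borel_measurable M" "AE x in M. Im (g x) = v x" by auto
  from uv(2,4) have "AE x in M. g x = Complex (u x) (v x)"
    by eventually_elim (simp add: complex_eq_iff)
  then show ?thesis
    using uv(1,3) by (intro bexI[of _ "\<lambda>x. Complex (u x) (v x)"]) auto
qed

lemma borel_measurable_lebesgue_of_borel:
  "f \<in> borel_measurable borel \<Longrightarrow> f \<in> borel_measurable lebesgue"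
  by (rule measurable_completion) simp

text \<open>A Borel representative keeps the norm and, for every \<open>z\<close> without exception,
  the inner product with the shifted window.\<close>

lemma L2_realE:
  assumes "f \<in> L2_real"
  obtains f' where "square_integrable f'" "AE t in lborel. f t = f' t" "norm_sq f' = (L2_norm f)\<^sup>2"
    "\<And>z. L2_inner f (tf_shift z gauss_window) = gabor f' z"
proof -
  from assms have fm: "f \<in> borel_measurable lebesgue" and f2: "integrable lebesgue (\<lambda>t. (cmod (f t))\<^sup>2)"
    by (auto simp: L2_real_def)
  from completion_ex_borel_measurable_complex[OF fm] obtain f' where
    [measurable]: "f' \<in> borel_measurable borel" and ae: "AE t in lborel. f t = f' t" by auto
  have ae': "AE t in lebesgue. f t = f' t" using ae by (rule AE_completion)
  note [measurable] = fm borel_measurable_lebesgue_of_borel[OF \<open>f' \<in> borel_measurable borel\<close>]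
  have "integrable lebesgue (\<lambda>t. (cmod (f' t))\<^sup>2)"
    using f2 by (rule integrable_cong_AE_imp) (use ae' in \<open>auto elim: eventually_mono\<close>)
  then have "integrable lborel (\<lambda>t. (cmod (f' t))\<^sup>2)"
    by (subst (asm) integrable_completion) auto
  then have "square_integrable f'" by (simp add: square_integrable_def)
  moreover have "norm_sq f' = (L2_norm f)\<^sup>2"
  proof -
    have "(LINT t|lebesgue. (cmod (f t))\<^sup>2) = (LINT t|lebesgue. (cmod (f' t))\<^sup>2)"
      by (rule integral_cong_AE) (use ae' in \<open>auto elim: eventually_mono\<close>)
    also have "\<dots> = norm_sq f'"
      unfolding norm_sq_def by (rule integral_completion) simp
    finally show ?thesis by (simp add: L2_norm_def)
  qed
  moreover have "L2_inner f (tf_shift z gauss_window) = gabor f' z" for z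
  proof -
    have [measurable]: "tf_shift z gauss_window \<in> borel_measurable lebesgue"
      by (rule borel_measurable_lebesgue_of_borel) measurable
    have "L2_inner f (tf_shift z gauss_window) = (LINT t|lebesgue. f' t * cnj (tf_shift z gauss_window t))"
      unfolding L2_inner_def by (rule integral_cong_AE) (use ae' in \<open>auto elim: eventually_mono\<close>)
    also have "\<dots> = gabor f' z"
      unfolding gabor_def by (rule integral_completion) simp
    finally show ?thesis .
  qed
  ultimately show ?thesis using ae that by blast
qed

lemma square_integrable_L2_real:
  assumes "square_integrable f"
  shows "f \<in> L2_real" "L2_norm f = sqrt (norm_sq f)"
proof -
  have [measurable]: "f \<in> borel_measurable borel" and f2: "integrable lborel (\<lambda>t. (cmod (f t))\<^sup>2)"
    using assms by (auto simp: square_integrable_def)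
  have "f \<in> borel_measurable lebesgue" by (rule borel_measurable_lebesgue_of_borel) simp
  moreover have "integrable lebesgue (\<lambda>t. (cmod (f t))\<^sup>2)"
    using f2 by (subst integrable_completion) auto
  ultimately show "f \<in> L2_real" by (simp add: L2_real_def)
  show "L2_norm f = sqrt (norm_sq f)"
    unfolding L2_norm_def norm_sq_def by (subst integral_completion) auto
qed

text \<open>On a space of nonzero measure the essential supremum of a nonnegative function is at
  least 0. It is therefore a finite real, and \<open>real_of_ereal\<close> returns it faithfully
  rather than by default.\<close>

lemma Linf_norm_AE_le:
  assumes "F \<in> Linf M" "emeasure M (space M) \<noteq> 0"
  shows "AE x in M. norm (F x) \<le> Linf_norm M F" "0 \<le> Linf_norm M F"
proof -
  let ?e = "esssup M (\<lambda>x. ereal (norm (F x)))"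
  have [measurable]: "F \<in> borel_measurable M" and fin: "?e < \<infinity>"
    using assms(1) by (auto simp: Linf_def)
  have "esssup M (\<lambda>x. 0 :: ereal) \<le> ?e"
    by (rule esssup_mono) auto
  then have "0 \<le> ?e"
    using assms(2) by (simp add: esssup_const)
  then have e: "?e = ereal (Linf_norm M F)" and "0 \<le> Linf_norm M F"
    using fin by (auto simp: Linf_norm_def ereal_real real_of_ereal_pos)
  then show "0 \<le> Linf_norm M F" by simp
  show "AE x in M. norm (F x) \<le> Linf_norm M F"
    using esssup_AE[of "\<lambda>x. ereal (norm (F x))" M] by eventually_elim (simp add: e)
qed

theorem corollary7:
  fixes F :: "complex \<Rightarrow> real" and a :: complex
  assumes "F \<in> L1 lebesgue \<inter> Linf lebesgue"
    and "\<not> (AE z in lebesgue. F z = 0)"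
    and "radial_wrt a F"
  shows "localization_op (\<lambda>z. complex_of_real (F z)) \<in> L2_real \<rightarrow> L2_real \<and>
    L2_op_norm (localization_op (\<lambda>z. complex_of_real (F z))) \<le>
      ereal (Linf_norm lebesgue F * (1 - exp (- (L1_norm lebesgue F / Linf_norm lebesgue F))))"
proof -
  define M where "M = Linf_norm lebesgue F"
  define L where "L = L1_norm lebesgue F"
  define C where "C = M * (1 - exp (- (L / M)))"
  have Fint: "integrable lebesgue F" and FLinf: "F \<in> Linf lebesgue"
    using assms(1) by (auto simp: L1_def)
  have "emeasure lebesgue (space (lebesgue :: complex measure)) \<noteq> 0"
    by simp
  note Finf = Linf_norm_AE_le[OF FLinf this, folded M_def]
  have "M \<noteq> 0"
  proof
    assume "M = 0"
    with Finf(1) have "AE z in lebesgue. F z = 0" by simp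
    with assms(2) show False ..
  qed
  with Finf(2) have M: "0 < M" by simp
  have L: "0 \<le> L" by (simp add: L_def L1_norm_def)
  have C: "0 \<le> C" using L M by (simp add: C_def)
  have Fm [measurable]: "F \<in> borel_measurable lebesgue" using Fint by auto
  \<comment> \<open>A Borel representative of the symbol inherits integrability, the radial profile
    and both norms.\<close>
  from completion_ex_borel_measurable_real[OF Fm] obtain F' where
    F'm [measurable]: "F' \<in> borel_measurable borel" and ae: "AE z in lborel. F z = F' z" by auto
  note [measurable] = borel_measurable_lebesgue_of_borel[OF F'm]
  have ae': "AE z in lebesgue. F z = F' z" using ae by (rule AE_completion)
  have "integrable lebesgue F'"
    using Fint by (rule integrable_cong_AE_imp) (use ae' in \<open>auto elim: eventually_mono\<close>)
  then have F': "integrable lborel F'"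
    by (subst (asm) integrable_completion) auto
  obtain w where w: "AE z in lebesgue. F z = w (cmod (z - a))"
    using assms(3) by (auto simp: radial_wrt_def)
  have radial: "AE z in lborel. F' z = w (cmod (z - a))"
    using w[unfolded AE_completion_iff] ae by eventually_elim simp
  have dens: "bounded_density (\<lambda>z. \<bar>F' z\<bar>) L M"
  proof
    show "AE z in lborel. \<bar>F' z\<bar> \<le> M"
      using Finf(1)[unfolded AE_completion_iff] ae by eventually_elim simp
    have "L = (LINT z|lebesgue. \<bar>F' z\<bar>)"
      unfolding L_def L1_norm_def
      by (rule integral_cong_AE) (use ae' in \<open>auto elim: eventually_mono\<close>)
    also have "\<dots> = (LINT z|lborel. \<bar>F' z\<bar>)"
      by (rule integral_completion) simp
    finally show "(\<integral>\<^sup>+z. ennreal \<bar>F' z\<bar> \<partial>lborel) \<le> ennreal L"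
      using F' by (subst nn_integral_eq_integral) auto
  qed (use L M in auto)
  have main: "localization_op (\<lambda>z. complex_of_real (F z)) f \<in> L2_real
      \<and> L2_norm (localization_op (\<lambda>z. complex_of_real (F z)) f) \<le> C * L2_norm f" if "f \<in> L2_real" for f
  proof -
    from that obtain f' where f': "square_integrable f'" and nf: "norm_sq f' = (L2_norm f)\<^sup>2"
      and inner: "\<And>z. L2_inner f (tf_shift z gauss_window) = gabor f' z"
      by (rule L2_realE) blast
    note [measurable] = borel_measurable_gabor[OF f']
      borel_measurable_lebesgue_of_borel[OF borel_measurable_gabor[OF f']]
    \<comment> \<open>Equality holds at every point \<open>t\<close>: for fixed \<open>t\<close>,
      replacing \<open>F\<close> by \<open>F'\<close> alters the integrand in \<open>z\<close> only
      on a null set.\<close>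
    have eq: "localization_op (\<lambda>z. complex_of_real (F z)) f = loc_op F' f'"
    proof
      fix t
      have [measurable]: "(\<lambda>z. tf_shift z gauss_window t) \<in> borel_measurable lebesgue"
        by (rule borel_measurable_lebesgue_of_borel) measurable
      have "localization_op (\<lambda>z. complex_of_real (F z)) f t
          = (LINT z|lebesgue. of_real (F' z) * gabor f' z * tf_shift z gauss_window t)"
        unfolding localization_op_def inner
        by (rule integral_cong_AE)
          (use ae' in \<open>auto elim: eventually_mono\<close>)
      also have "\<dots> = loc_op F' f' t"
        unfolding loc_op_def by (rule integral_completion) measurable
      finally show "localization_op (\<lambda>z. complex_of_real (F z)) f t = loc_op F' f' t" .
    qed
    note T = loc_op_norm_sq_le[OF F' radial dens f', folded C_def]
    have "0 \<le> L2_norm f" by (simp add: L2_norm_def)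
    have "sqrt (norm_sq (loc_op F' f')) \<le> sqrt (C\<^sup>2 * (L2_norm f)\<^sup>2)"
      using T(2) nf by simp
    also have "\<dots> = C * L2_norm f"
      using C \<open>0 \<le> L2_norm f\<close> by (simp add: real_sqrt_mult)
    finally show ?thesis
      using square_integrable_L2_real[OF T(1)] by (simp add: eq)
  qed
  have "L2_op_norm (localization_op (\<lambda>z. complex_of_real (F z))) \<le> ereal C"
    unfolding L2_op_norm_def
  proof (rule SUP_least)
    fix f assume "f \<in> {f \<in> L2_real. L2_norm f \<le> 1}"
    then have "f \<in> L2_real" "L2_norm f \<le> 1" by auto
    then have "L2_norm (localization_op (\<lambda>z. complex_of_real (F z)) f) \<le> C"
      using main[of f] C mult_left_mono[of "L2_norm f" 1 C] by auto
    then show "ereal (L2_norm (localization_op (\<lambda>z. complex_of_real (F z)) f)) \<le> ereal C" by simp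
  qed
  then show ?thesis
    using main by (auto simp: C_def M_def L_def)
qed

end
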